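(* Let $(A,\star,\circ,P)$ be a relative pre-Poisson algebra and let $(A,\cdot,[-,-],P)$ be its sub-adjacent relative Poisson algebra. Let $\{e_1,\dots,e_n\}$ be a basis of $A$ and $\{e_1^*,\dots,e_n^*\}$ be the dual basis. Then $$r=\sum_{i=1}^n(e_i\otimes e_i^*-e_i^*\otimes e_i)$$ is an antisymmetric solution of the $(-P+P^* )$-RPYBE in the relative Poisson algebra $(A\ltimes_{-\mathcal L_\star^*,\mathcal L_\circ^*}A^*,P-P^* )$. Further, the relative Poisson algebra $(A\ltimes_{-\mathcal L_\star^*,\mathcal L_\circ^*}A^*,P-P^* )$ is dually represented by $-P+P^*$, and hence there is a relative Poisson bialgebra $(A\ltimes_{-\mathcal L_\star^*,\mathcal L_\circ^*}A^*,\cdot,[-,-],\Delta,\delta,P-P^*,-P+P^* )$, where for all $u\in A\ltimes_{-\mathcal L_\star^*,\mathcal L_\circ^*}A^*$ $$\Delta(u)=(\mathrm{id}\otimes\mathcal L(u)-\mathcal L(u)\otimes\mathrm{id})r,\qquad \delta(u)=(\mathrm{ad}(u)\otimes\mathrm{id}+\mathrm{id}\otimes\mathrm{ad}(u))r.$$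
   Context: All vector spaces are finite-dimensional over an algebraically closed field $\mathbb K$ of characteristic zero. Relative Poisson algebra. $(A,\cdot,[-,-],P)$, abbreviated $(A,P)$: $(A,\cdot)$ is a commutative associative (not necessarily unital) algebra, $(A,[-,-])$ is a Lie algebra, $P:A\to A$ is a linear map that is a derivation of both $\cdot$ and $[-,-]$, and $[z,x\cdot y]=[z,x]\cdot y+x\cdot[z,y]+x\cdot y\cdot P(z)$ for all $x,y,z\in A$. Relative pre-Poisson algebra $(A,\star,\circ,P)$. $(A,\star)$ is a Zinbiel algebra, i.e. $x\star(y\star z)=(y\star x)\star z+(x\star y)\star z$; $(A,\circ)$ is a pre-Lie algebra, i.e. $(x\circ y)\circ z-x\circ(y\circ z)=(y\circ x)\circ z-y\circ(x\circ z)$; $P:A\to A$ is a linear map that is a derivation of both $\star$ and $\circ$; and for all $x,y,z$: $(x\star y+y\star x)\circ z-x\star(y\circ z)-y\star(x\circ z)+(x\star y+y\star x)\star P(z)=0$ and $y\circ(x\star z)-x\star(y\circ z)+(x\circ y-y\circ x)\star z-(x\star P(y)+P(y)\star x)\star z=0$. Its sub-adjacent relative Poisson algebra is $(A,\cdot,[-,-],P)$ with $x\cdot y=x\star y+y\star x$, $[x,y]=x\circ y-y\circ x$. Write $\mathcal L_\star(x)y=x\star y$, $\mathcal L_\circ(x)y=x\circ y$. Notation. $\mathcal L(x)y=x\cdot y$, $\mathrm{ad}(x)y=[x,y]$, $\tau(x\otimes y)=y\otimes x$. For a linear map $\varphi:A\to\mathrm{End}(V)$, $\varphi^*:A\to\mathrm{End}(V^*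 )$ is defined by $\langle\varphi^*(x)u^*,v\rangle=-\langle u^*,\varphi(x)v\rangle$ (with a sign). $P^*:A^*\to A^*$ is the usual dual map of $P$ (no sign). For linear maps $\phi_i:V_i\to V_i$, $\phi_1+\phi_2$ is the map $v_1+v_2\mapsto\phi_1(v_1)+\phi_2(v_2)$ on $V_1\oplus V_2$; thus $(P-P^* )(x+a^* )=P(x)-P^*(a^* )$ and $(-P+P^* )(x+a^* )=-P(x)+P^*(a^* )$. The semi-direct product $(A\ltimes_{-\mathcal L_\star^*,\mathcal L_\circ^*}A^*,P-P^* )$ is $A\oplus A^*$ with $(x+a^* )\cdot(y+b^* )=x\cdot y-\mathcal L_\star^*(x)b^*-\mathcal L_\star^*(y)a^*$, $[x+a^*,y+b^*]=[x,y]+\mathcal L_\circ^*(x)b^*-\mathcal L_\circ^*(y)a^*$. A linear map $Q:A\to A$ dually represents a relative Poisson algebra $(A,P)$ if for all $x,y,z\in A$: $x\cdot Q(y)-P(x)\cdot y-Q(x\cdot y)=0$; $[x,Q(y)]-[P(x),y]-Q([x,y])=0$; $[x,y\cdot z]+[y,z\cdot x]+[z,x\cdot y]+Q(x\cdot y\cdot z)=0$. RPYBE. For $r=\sum_ia_i\otimes b_i\in A\otimes A$ and a bilinear operation $\diamond$: $r_{12}\diamond r_{13}=\sum a_i\diamond a_j\otimes b_i\otimes b_j$, $r_{12}\diamond r_{23}=\sum a_i\otimes b_i\diamond a_j\otimes b_j$, $r_{13}\diamond r_{23}=\sum a_i\otimes a_j\otimes b_i\diamond b_j$. For a linear map $Q:A\to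 A$, $r$ is a solution of the $Q$-RPYBE in $(A,P)$ if $r_{12}\cdot r_{13}-r_{12}\cdot r_{23}+r_{13}\cdot r_{23}=0$, $[r_{12},r_{13}]+[r_{12},r_{23}]+[r_{13},r_{23}]=0$, $(P\otimes\mathrm{id}-\mathrm{id}\otimes Q)r=0$ and $(Q\otimes\mathrm{id}-\mathrm{id}\otimes P)r=0$. $r$ is antisymmetric if $r+\tau(r)=0$. Relative Poisson coalgebra $(A,\Delta,\delta,Q)$. Linear maps $\Delta,\delta:A\to A\otimes A$, $Q:A\to A$ with $\tau\Delta=\Delta$, $(\mathrm{id}\otimes\Delta)\Delta=(\Delta\otimes\mathrm{id})\Delta$; $\tau\delta=-\delta$, $(\mathrm{id}+\xi+\xi^2)(\mathrm{id}\otimes\delta)\delta=0$ where $\xi(x\otimes y\otimes z)=y\otimes z\otimes x$; $\Delta Q=(Q\otimes\mathrm{id}+\mathrm{id}\otimes Q)\Delta$; $\delta Q=(Q\otimes\mathrm{id}+\mathrm{id}\otimes Q)\delta$; and $(\mathrm{id}\otimes\Delta)\delta(x)-(\delta\otimes\mathrm{id})\Delta(x)-(\tau\otimes\mathrm{id})(\mathrm{id}\otimes\delta)\Delta(x)-(Q\otimes\mathrm{id}\otimes\mathrm{id})(\Delta\otimes\mathrm{id})\Delta(x)=0$ for all $x\in A$. Relative Poisson bialgebra $(A,\cdot,[-,-],\Delta,\delta,P,Q)$. $(A,\cdot,[-,-],P)$ is a relative Poisson algebra; $(A,\Delta,\delta,Q)$ is a relative Poisson coalgebra; $Q$ dually represents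 $(A,P)$; $\Delta P=(P\otimes\mathrm{id}-\mathrm{id}\otimes Q)\Delta$, $\delta P=(P\otimes\mathrm{id}-\mathrm{id}\otimes Q)\delta$, $(\Delta\otimes\mathrm{id})\Delta(P+Q)=0$; and for all $x,y\in A$: $\Delta(x\cdot y)=(\mathcal L(x)\otimes\mathrm{id})\Delta(y)+(\mathrm{id}\otimes\mathcal L(y))\Delta(x)$; $\delta([x,y])=(\mathrm{ad}(x)\otimes\mathrm{id}+\mathrm{id}\otimes\mathrm{ad}(x))\delta(y)-(\mathrm{ad}(y)\otimes\mathrm{id}+\mathrm{id}\otimes\mathrm{ad}(y))\delta(x)$; $\delta(x\cdot y)-(\mathrm{id}\otimes\mathrm{ad}(y))\Delta(x)-(\mathcal L(x)\otimes\mathrm{id})\delta(y)-(\mathrm{id}\otimes\mathrm{ad}(x))\Delta(y)-(\mathcal L(y)\otimes\mathrm{id})\delta(x)-(\mathrm{id}\otimes Q)\Delta(x\cdot y)=0$; $\Delta([x,y])-(\mathcal L(y)\otimes\mathrm{id})\delta(x)-(\mathrm{id}\otimes\mathrm{ad}(x))\Delta(y)+(\mathrm{id}\otimes\mathcal L(y))\delta(x)-(\mathrm{ad}(x)\otimes\mathrm{id})\Delta(y)+\Delta(P(x)\cdot y)=0$. *)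

theory Defs
  imports
    "HOL-Computational_Algebra.Polynomial"
    "HOL-Library.Poly_Mapping"
    "HOL-Library.Function_Algebras"
    "HOL-Library.Product_Plus"
begin

section \<open>Linear structure on a carrier\<close>

text \<open>
  A vector space is a subspace \<open>V\<close> of an ambient vector space \<open>(scale, 'v)\<close>, with
  \<open>V = UNIV\<close> if the whole type is meant. Carriers are needed because the dual space is a
  proper subset of the type of all functions. All axioms below are relativised to \<open>V\<close>.
\<close>

locale fd_space = vector_space scale
  for scale :: "'k::{alg_closed_field, field_char_0} \<Rightarrow> 'v::ab_group_add \<Rightarrow> 'v" +
  fixes V :: "'v set"
  assumes subspace_carrier: "subspace V"
    and finite_dim: "\<exists>B. finite B \<and> B \<subseteq> V \<and> span B = V"

definition linear_endo ::
    "('k::field \<Rightarrow> 'v::ab_group_add \<Rightarrow> 'v) \<Rightarrow> 'v set \<Rightarrow> ('v \<Rightarrow> 'v) \<Rightarrow> bool" where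
  "linear_endo scale V f \<longleftrightarrow>
     (\<forall>x\<in>V. f x \<in> V) \<and>
     (\<forall>x\<in>V. \<forall>y\<in>V. f (x + y) = f x + f y) \<and>
     (\<forall>c. \<forall>x\<in>V. f (scale c x) = scale c (f x))"

definition bilinear_op ::
    "('k::field \<Rightarrow> 'v::ab_group_add \<Rightarrow> 'v) \<Rightarrow> 'v set \<Rightarrow> ('v \<Rightarrow> 'v \<Rightarrow> 'v) \<Rightarrow> bool" where
  "bilinear_op scale V m \<longleftrightarrow>
     (\<forall>x\<in>V. linear_endo scale V (\<lambda>y. m x y)) \<and> (\<forall>y\<in>V. linear_endo scale V (\<lambda>x. m x y))"

definition derivation_of :: "'v::ab_group_add set \<Rightarrow> ('v \<Rightarrow> 'v \<Rightarrow> 'v) \<Rightarrow> ('v \<Rightarrow> 'v) \<Rightarrow> bool" where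
  "derivation_of V m P \<longleftrightarrow> (\<forall>x\<in>V. \<forall>y\<in>V. P (m x y) = m (P x) y + m x (P y))"


section \<open>Tensor products\<close>

text \<open>
  \<open>V \<otimes> V\<close> and \<open>V \<otimes> V \<otimes> V\<close> are the free vector spaces on \<open>V \<times> V\<close> and \<open>V \<times> V \<times> V\<close> modulo the
  span of the multilinearity relations. A tensor is represented by a formal sum of pairs
  (triples), i.e. a finitely supported function to the field; equality of tensors is congruence
  modulo the relations. Hence a linear map into a tensor product is given by a choice of
  representatives and is required to be linear up to congruence.
\<close>

definition fscale :: "'k::field \<Rightarrow> ('b \<Rightarrow>\<^sub>0 'k) \<Rightarrow> ('b \<Rightarrow>\<^sub>0 'k)" where
  "fscale c p = Poly_Mapping.map (\<lambda>a. c * a) p"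

lemma lookup_fscale [simp]: "Poly_Mapping.lookup (fscale c p) b = c * Poly_Mapping.lookup p b"
  by (simp add: fscale_def map.rep_eq when_def)

global_interpretation fsum: vector_space "fscale :: 'k::field \<Rightarrow> ('b \<Rightarrow>\<^sub>0 'k) \<Rightarrow> ('b \<Rightarrow>\<^sub>0 'k)"
  by standard (auto intro!: poly_mapping_eqI simp: lookup_add algebra_simps)

text \<open>Linear extension of a map defined on the basis of a free vector space.\<close>

definition lin_ext :: "('b \<Rightarrow> ('c \<Rightarrow>\<^sub>0 'k::field)) \<Rightarrow> ('b \<Rightarrow>\<^sub>0 'k) \<Rightarrow> ('c \<Rightarrow>\<^sub>0 'k)" where
  "lin_ext f p = (\<Sum>b\<in>Poly_Mapping.keys p. fscale (Poly_Mapping.lookup p b) (f b))"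

abbreviation pure2 :: "'v \<Rightarrow> 'v \<Rightarrow> ('v \<times> 'v \<Rightarrow>\<^sub>0 'k::field)" where
  "pure2 x y \<equiv> Poly_Mapping.single (x, y) 1"

abbreviation pure3 :: "'v \<Rightarrow> 'v \<Rightarrow> 'v \<Rightarrow> ('v \<times> 'v \<times> 'v \<Rightarrow>\<^sub>0 'k::field)" where
  "pure3 x y z \<equiv> Poly_Mapping.single (x, y, z) 1"

definition bilinear_relations ::
    "('k::field \<Rightarrow> 'v::ab_group_add \<Rightarrow> 'v) \<Rightarrow> 'v set \<Rightarrow> ('v \<times> 'v \<Rightarrow>\<^sub>0 'k) set" where
  "bilinear_relations scale V =
     {pure2 (x + x') y - pure2 x y - pure2 x' y | x x' y. x \<in> V \<and> x' \<in> V \<and> y \<in> V} \<union>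
     {pure2 x (y + y') - pure2 x y - pure2 x y' | x y y'. x \<in> V \<and> y \<in> V \<and> y' \<in> V} \<union>
     {pure2 (scale c x) y - fscale c (pure2 x y) | c x y. x \<in> V \<and> y \<in> V} \<union>
     {pure2 x (scale c y) - fscale c (pure2 x y) | c x y. x \<in> V \<and> y \<in> V}"

definition trilinear_relations ::
    "('k::field \<Rightarrow> 'v::ab_group_add \<Rightarrow> 'v) \<Rightarrow> 'v set \<Rightarrow> ('v \<times> 'v \<times> 'v \<Rightarrow>\<^sub>0 'k) set" where
  "trilinear_relations scale V =
     {pure3 (x + x') y z - pure3 x y z - pure3 x' y z | x x' y z.
        x \<in> V \<and> x' \<in> V \<and> y \<in> V \<and> z \<in> V} \<union>
     {pure3 x (y + y') z - pure3 x y z - pure3 x y' z | x y y' z.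
        x \<in> V \<and> y \<in> V \<and> y' \<in> V \<and> z \<in> V} \<union>
     {pure3 x y (z + z') - pure3 x y z - pure3 x y z' | x y z z'.
        x \<in> V \<and> y \<in> V \<and> z \<in> V \<and> z' \<in> V} \<union>
     {pure3 (scale c x) y z - fscale c (pure3 x y z) | c x y z. x \<in> V \<and> y \<in> V \<and> z \<in> V} \<union>
     {pure3 x (scale c y) z - fscale c (pure3 x y z) | c x y z. x \<in> V \<and> y \<in> V \<and> z \<in> V} \<union>
     {pure3 x y (scale c z) - fscale c (pure3 x y z) | c x y z. x \<in> V \<and> y \<in> V \<and> z \<in> V}"

definition tensor2_eq ::
    "('k::field \<Rightarrow> 'v::ab_group_add \<Rightarrow> 'v) \<Rightarrow> 'v set \<Rightarrow>
     ('v \<times> 'v \<Rightarrow>\<^sub>0 'k) \<Rightarrow> ('v \<times> 'v \<Rightarrow>\<^sub>0 'k) \<Rightarrow> bool" where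
  "tensor2_eq scale V p q \<longleftrightarrow> p - q \<in> fsum.span (bilinear_relations scale V)"

definition tensor3_eq ::
    "('k::field \<Rightarrow> 'v::ab_group_add \<Rightarrow> 'v) \<Rightarrow> 'v set \<Rightarrow>
     ('v \<times> 'v \<times> 'v \<Rightarrow>\<^sub>0 'k) \<Rightarrow> ('v \<times> 'v \<times> 'v \<Rightarrow>\<^sub>0 'k) \<Rightarrow> bool" where
  "tensor3_eq scale V p q \<longleftrightarrow> p - q \<in> fsum.span (trilinear_relations scale V)"

definition tensor2_space :: "'v set \<Rightarrow> ('v \<times> 'v \<Rightarrow>\<^sub>0 'k::field) set" where
  "tensor2_space V = {p. Poly_Mapping.keys p \<subseteq> V \<times> V}"

context fd_space
begin

abbreviation teq2 (infix "\<approx>\<^sub>2" 50) where "p \<approx>\<^sub>2 q \<equiv> tensor2_eq scale V p q"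
abbreviation teq3 (infix "\<approx>\<^sub>3" 50) where "p \<approx>\<^sub>3 q \<equiv> tensor3_eq scale V p q"

end

definition linear_to_tensor2 ::
    "('k::field \<Rightarrow> 'v::ab_group_add \<Rightarrow> 'v) \<Rightarrow> 'v set \<Rightarrow> ('v \<Rightarrow> ('v \<times> 'v \<Rightarrow>\<^sub>0 'k)) \<Rightarrow> bool" where
  "linear_to_tensor2 scale V D \<longleftrightarrow>
     (\<forall>x\<in>V. D x \<in> tensor2_space V) \<and>
     (\<forall>x\<in>V. \<forall>y\<in>V. tensor2_eq scale V (D (x + y)) (D x + D y)) \<and>
     (\<forall>c. \<forall>x\<in>V. tensor2_eq scale V (D (scale c x)) (fscale c (D x)))"

text \<open>\<open>f \<otimes> g\<close> and \<open>f \<otimes> g \<otimes> h\<close> for linear endomorphisms.\<close>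

definition tmap2 :: "('v \<Rightarrow> 'v) \<Rightarrow> ('v \<Rightarrow> 'v) \<Rightarrow> ('v \<times> 'v \<Rightarrow>\<^sub>0 'k::field) \<Rightarrow> ('v \<times> 'v \<Rightarrow>\<^sub>0 'k)" where
  "tmap2 f g = lin_ext (\<lambda>(x, y). pure2 (f x) (g y))"

definition tmap3 :: "('v \<Rightarrow> 'v) \<Rightarrow> ('v \<Rightarrow> 'v) \<Rightarrow> ('v \<Rightarrow> 'v) \<Rightarrow>
    ('v \<times> 'v \<times> 'v \<Rightarrow>\<^sub>0 'k::field) \<Rightarrow> ('v \<times> 'v \<times> 'v \<Rightarrow>\<^sub>0 'k)" where
  "tmap3 f g h = lin_ext (\<lambda>(x, y, z). pure3 (f x) (g y) (h z))"

text \<open>\<open>id \<otimes> D\<close> and \<open>D \<otimes> id\<close> for \<open>D : V \<rightarrow> V \<otimes> V\<close>.\<close>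

definition id_tensor :: "('v \<Rightarrow> ('v \<times> 'v \<Rightarrow>\<^sub>0 'k::field)) \<Rightarrow>
    ('v \<times> 'v \<Rightarrow>\<^sub>0 'k) \<Rightarrow> ('v \<times> 'v \<times> 'v \<Rightarrow>\<^sub>0 'k)" where
  "id_tensor D = lin_ext (\<lambda>(x, y). lin_ext (\<lambda>(a, b). pure3 x a b) (D y))"

definition tensor_id :: "('v \<Rightarrow> ('v \<times> 'v \<Rightarrow>\<^sub>0 'k::field)) \<Rightarrow>
    ('v \<times> 'v \<Rightarrow>\<^sub>0 'k) \<Rightarrow> ('v \<times> 'v \<times> 'v \<Rightarrow>\<^sub>0 'k)" where
  "tensor_id D = lin_ext (\<lambda>(x, y). lin_ext (\<lambda>(a, b). pure3 a b y) (D x))"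

text \<open>The twist \<open>\<tau>\<close>, its extension \<open>\<tau> \<otimes> id\<close>, and the cyclic permutation \<open>\<xi>\<close>.\<close>

definition twist :: "('v \<times> 'v \<Rightarrow>\<^sub>0 'k::field) \<Rightarrow> ('v \<times> 'v \<Rightarrow>\<^sub>0 'k)" where
  "twist = lin_ext (\<lambda>(x, y). pure2 y x)"

definition twist_id :: "('v \<times> 'v \<times> 'v \<Rightarrow>\<^sub>0 'k::field) \<Rightarrow> ('v \<times> 'v \<times> 'v \<Rightarrow>\<^sub>0 'k)" where
  "twist_id = lin_ext (\<lambda>(x, y, z). pure3 y x z)"

definition cyc :: "('v \<times> 'v \<times> 'v \<Rightarrow>\<^sub>0 'k::field) \<Rightarrow> ('v \<times> 'v \<times> 'v \<Rightarrow>\<^sub>0 'k)" where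
  "cyc = lin_ext (\<lambda>(x, y, z). pure3 y z x)"

definition antisymmetric_tensor ::
    "('k::field \<Rightarrow> 'v::ab_group_add \<Rightarrow> 'v) \<Rightarrow> 'v set \<Rightarrow> ('v \<times> 'v \<Rightarrow>\<^sub>0 'k) \<Rightarrow> bool" where
  "antisymmetric_tensor scale V r \<longleftrightarrow>
     r \<in> tensor2_space V \<and> tensor2_eq scale V (r + twist r) 0"

text \<open>\<open>r\<^sub>1\<^sub>2 \<diamond> r\<^sub>1\<^sub>3\<close>, \<open>r\<^sub>1\<^sub>2 \<diamond> r\<^sub>2\<^sub>3\<close> and \<open>r\<^sub>1\<^sub>3 \<diamond> r\<^sub>2\<^sub>3\<close> for a bilinear operation \<open>\<diamond>\<close>.\<close>

definition r12_r13 ::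
    "('v \<Rightarrow> 'v \<Rightarrow> 'v) \<Rightarrow> ('v \<times> 'v \<Rightarrow>\<^sub>0 'k::field) \<Rightarrow> ('v \<times> 'v \<times> 'v \<Rightarrow>\<^sub>0 'k)" where
  "r12_r13 m r = lin_ext (\<lambda>(a, b). lin_ext (\<lambda>(a', b'). pure3 (m a a') b b') r) r"

definition r12_r23 ::
    "('v \<Rightarrow> 'v \<Rightarrow> 'v) \<Rightarrow> ('v \<times> 'v \<Rightarrow>\<^sub>0 'k::field) \<Rightarrow> ('v \<times> 'v \<times> 'v \<Rightarrow>\<^sub>0 'k)" where
  "r12_r23 m r = lin_ext (\<lambda>(a, b). lin_ext (\<lambda>(a', b'). pure3 a (m b a') b') r) r"

definition r13_r23 ::
    "('v \<Rightarrow> 'v \<Rightarrow> 'v) \<Rightarrow> ('v \<times> 'v \<Rightarrow>\<^sub>0 'k::field) \<Rightarrow> ('v \<times> 'v \<times> 'v \<Rightarrow>\<^sub>0 'k)" where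
  "r13_r23 m r = lin_ext (\<lambda>(a, b). lin_ext (\<lambda>(a', b'). pure3 a a' (m b b')) r) r"


section \<open>Relative Poisson algebras and bialgebras\<close>

locale relative_poisson_algebra = fd_space scale V
  for scale :: "'k::{alg_closed_field, field_char_0} \<Rightarrow> 'v::ab_group_add \<Rightarrow> 'v"
    and V :: "'v set" +
  fixes mul br :: "'v \<Rightarrow> 'v \<Rightarrow> 'v" and P :: "'v \<Rightarrow> 'v"
  assumes mul_bilinear: "bilinear_op scale V mul"
    and mul_comm: "\<lbrakk>x \<in> V; y \<in> V\<rbrakk> \<Longrightarrow> mul x y = mul y x"
    and mul_assoc: "\<lbrakk>x \<in> V; y \<in> V; z \<in> V\<rbrakk> \<Longrightarrow> mul (mul x y) z = mul x (mul y z)"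
    and br_bilinear: "bilinear_op scale V br"
    and br_alternating: "x \<in> V \<Longrightarrow> br x x = 0"
    and jacobi: "\<lbrakk>x \<in> V; y \<in> V; z \<in> V\<rbrakk> \<Longrightarrow>
      br x (br y z) + br y (br z x) + br z (br x y) = 0"
    and P_linear: "linear_endo scale V P"
    and P_derivation_mul: "derivation_of V mul P"
    and P_derivation_br: "derivation_of V br P"
    and relative_leibniz: "\<lbrakk>x \<in> V; y \<in> V; z \<in> V\<rbrakk> \<Longrightarrow>
      br z (mul x y) = mul (br z x) y + mul x (br z y) + mul (mul x y) (P z)"

locale dually_represented = relative_poisson_algebra scale V mul br P
  for scale :: "'k::{alg_closed_field, field_char_0} \<Rightarrow> 'v::ab_group_add \<Rightarrow> 'v"
    and V mul br P +
  fixes Q :: "'v \<Rightarrow> 'v"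
  assumes Q_linear: "linear_endo scale V Q"
    and Q_mul: "\<lbrakk>x \<in> V; y \<in> V\<rbrakk> \<Longrightarrow> mul x (Q y) - mul (P x) y - Q (mul x y) = 0"
    and Q_br: "\<lbrakk>x \<in> V; y \<in> V\<rbrakk> \<Longrightarrow> br x (Q y) - br (P x) y - Q (br x y) = 0"
    and Q_cyclic: "\<lbrakk>x \<in> V; y \<in> V; z \<in> V\<rbrakk> \<Longrightarrow>
      br x (mul y z) + br y (mul z x) + br z (mul x y) + Q (mul (mul x y) z) = 0"

locale rpybe_solution = relative_poisson_algebra scale V mul br P
  for scale :: "'k::{alg_closed_field, field_char_0} \<Rightarrow> 'v::ab_group_add \<Rightarrow> 'v"
    and V mul br P +
  fixes Q :: "'v \<Rightarrow> 'v" and r :: "'v \<times> 'v \<Rightarrow>\<^sub>0 'k"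
  assumes Q_linear: "linear_endo scale V Q"
    and r_tensor: "r \<in> tensor2_space V"
    and associative_ybe: "r12_r13 mul r - r12_r23 mul r + r13_r23 mul r \<approx>\<^sub>3 0"
    and classical_ybe: "r12_r13 br r + r12_r23 br r + r13_r23 br r \<approx>\<^sub>3 0"
    and P_Q_invariant: "tmap2 P id r - tmap2 id Q r \<approx>\<^sub>2 0"
    and Q_P_invariant: "tmap2 Q id r - tmap2 id P r \<approx>\<^sub>2 0"

locale relative_poisson_coalgebra = fd_space scale V
  for scale :: "'k::{alg_closed_field, field_char_0} \<Rightarrow> 'v::ab_group_add \<Rightarrow> 'v"
    and V :: "'v set" +
  fixes \<Delta> \<delta> :: "'v \<Rightarrow> ('v \<times> 'v \<Rightarrow>\<^sub>0 'k)" and Q :: "'v \<Rightarrow> 'v"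
  assumes \<Delta>_linear: "linear_to_tensor2 scale V \<Delta>"
    and \<delta>_linear: "linear_to_tensor2 scale V \<delta>"
    and coQ_linear: "linear_endo scale V Q"
    and cocommutative: "x \<in> V \<Longrightarrow> twist (\<Delta> x) \<approx>\<^sub>2 \<Delta> x"
    and coassociative: "x \<in> V \<Longrightarrow> id_tensor \<Delta> (\<Delta> x) \<approx>\<^sub>3 tensor_id \<Delta> (\<Delta> x)"
    and coantisymmetric: "x \<in> V \<Longrightarrow> twist (\<delta> x) \<approx>\<^sub>2 - \<delta> x"
    and cojacobi: "x \<in> V \<Longrightarrow>
      id_tensor \<delta> (\<delta> x) + cyc (id_tensor \<delta> (\<delta> x)) + cyc (cyc (id_tensor \<delta> (\<delta> x))) \<approx>\<^sub>3 0"
    and \<Delta>_Q: "x \<in> V \<Longrightarrow> \<Delta> (Q x) \<approx>\<^sub>2 tmap2 Q id (\<Delta> x) + tmap2 id Q (\<Delta> x)"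
    and \<delta>_Q: "x \<in> V \<Longrightarrow> \<delta> (Q x) \<approx>\<^sub>2 tmap2 Q id (\<delta> x) + tmap2 id Q (\<delta> x)"
    and relative_coleibniz: "x \<in> V \<Longrightarrow>
      id_tensor \<Delta> (\<delta> x) - tensor_id \<delta> (\<Delta> x) - twist_id (id_tensor \<delta> (\<Delta> x))
        - tmap3 Q id id (tensor_id \<Delta> (\<Delta> x)) \<approx>\<^sub>3 0"

locale relative_poisson_bialgebra =
  dually_represented scale V mul br P Q + relative_poisson_coalgebra scale V \<Delta> \<delta> Q
  for scale :: "'k::{alg_closed_field, field_char_0} \<Rightarrow> 'v::ab_group_add \<Rightarrow> 'v"
    and V mul br \<Delta> \<delta> P Q +
  assumes \<Delta>_P: "x \<in> V \<Longrightarrow> \<Delta> (P x) \<approx>\<^sub>2 tmap2 P id (\<Delta> x) - tmap2 id Q (\<Delta> x)"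
    and \<delta>_P: "x \<in> V \<Longrightarrow> \<delta> (P x) \<approx>\<^sub>2 tmap2 P id (\<delta> x) - tmap2 id Q (\<delta> x)"
    and \<Delta>_\<Delta>_P_Q: "x \<in> V \<Longrightarrow> tensor_id \<Delta> (\<Delta> (P x + Q x)) \<approx>\<^sub>3 0"
    and \<Delta>_mul: "\<lbrakk>x \<in> V; y \<in> V\<rbrakk> \<Longrightarrow>
      \<Delta> (mul x y) \<approx>\<^sub>2 tmap2 (mul x) id (\<Delta> y) + tmap2 id (mul y) (\<Delta> x)"
    and \<delta>_br: "\<lbrakk>x \<in> V; y \<in> V\<rbrakk> \<Longrightarrow>
      \<delta> (br x y) \<approx>\<^sub>2 (tmap2 (br x) id (\<delta> y) + tmap2 id (br x) (\<delta> y))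
        - (tmap2 (br y) id (\<delta> x) + tmap2 id (br y) (\<delta> x))"
    and \<delta>_mul: "\<lbrakk>x \<in> V; y \<in> V\<rbrakk> \<Longrightarrow>
      \<delta> (mul x y) - tmap2 id (br y) (\<Delta> x) - tmap2 (mul x) id (\<delta> y)
        - tmap2 id (br x) (\<Delta> y) - tmap2 (mul y) id (\<delta> x) - tmap2 id Q (\<Delta> (mul x y)) \<approx>\<^sub>2 0"
    and \<Delta>_br: "\<lbrakk>x \<in> V; y \<in> V\<rbrakk> \<Longrightarrow>
      \<Delta> (br x y) - tmap2 (mul y) id (\<delta> x) - tmap2 id (br x) (\<Delta> y)
        + tmap2 id (mul y) (\<delta> x) - tmap2 (br x) id (\<Delta> y) + \<Delta> (mul (P x) y) \<approx>\<^sub>2 0"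


section \<open>Relative pre-Poisson algebras\<close>

locale relative_pre_poisson_algebra = fd_space scale V
  for scale :: "'k::{alg_closed_field, field_char_0} \<Rightarrow> 'v::ab_group_add \<Rightarrow> 'v"
    and V :: "'v set" +
  fixes star circ :: "'v \<Rightarrow> 'v \<Rightarrow> 'v" and P :: "'v \<Rightarrow> 'v"
  assumes star_bilinear: "bilinear_op scale V star"
    and zinbiel: "\<lbrakk>x \<in> V; y \<in> V; z \<in> V\<rbrakk> \<Longrightarrow>
      star x (star y z) = star (star y x) z + star (star x y) z"
    and circ_bilinear: "bilinear_op scale V circ"
    and pre_lie: "\<lbrakk>x \<in> V; y \<in> V; z \<in> V\<rbrakk> \<Longrightarrow>
      circ (circ x y) z - circ x (circ y z) = circ (circ y x) z - circ y (circ x z)"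
    and P_linear: "linear_endo scale V P"
    and P_derivation_star: "derivation_of V star P"
    and P_derivation_circ: "derivation_of V circ P"
    and pre_poisson1: "\<lbrakk>x \<in> V; y \<in> V; z \<in> V\<rbrakk> \<Longrightarrow>
      circ (star x y + star y x) z - star x (circ y z) - star y (circ x z)
        + star (star x y + star y x) (P z) = 0"
    and pre_poisson2: "\<lbrakk>x \<in> V; y \<in> V; z \<in> V\<rbrakk> \<Longrightarrow>
      circ y (star x z) - star x (circ y z) + star (circ x y - circ y x) z
        - star (star x (P y) + star (P y) x) z = 0"

definition subadjacent_mul :: "('v::ab_group_add \<Rightarrow> 'v \<Rightarrow> 'v) \<Rightarrow> 'v \<Rightarrow> 'v \<Rightarrow> 'v" where
  "subadjacent_mul star x y = star x y + star y x"

definition subadjacent_br :: "('v::ab_group_add \<Rightarrow> 'v \<Rightarrow> 'v) \<Rightarrow> 'v \<Rightarrow> 'v \<Rightarrow> 'v" where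
  "subadjacent_br circ x y = circ x y - circ y x"


section \<open>Dual spaces and semi-direct products\<close>

definition dual_space :: "('k::field \<Rightarrow> 'a::ab_group_add \<Rightarrow> 'a) \<Rightarrow> ('a \<Rightarrow> 'k) set" where
  "dual_space scale = {f. Vector_Spaces.linear scale (*) f}"

text \<open>The dual \<open>\<phi>\<^sup>*\<close> of a representation carries a sign, the dual \<open>P\<^sup>*\<close> of a map does not.\<close>

definition dual_rep :: "('a \<Rightarrow> 'a \<Rightarrow> 'a) \<Rightarrow> 'a \<Rightarrow> ('a \<Rightarrow> 'k::field) \<Rightarrow> ('a \<Rightarrow> 'k)" where
  "dual_rep \<phi> x u = (\<lambda>v. - u (\<phi> x v))"

definition dual_map :: "('a \<Rightarrow> 'a) \<Rightarrow> ('a \<Rightarrow> 'k) \<Rightarrow> ('a \<Rightarrow> 'k)" where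
  "dual_map P u = u \<circ> P"

text \<open>An element \<open>x + a\<^sup>*\<close> of \<open>A \<oplus> A\<^sup>*\<close> is the pair \<open>(x, a\<^sup>*)\<close>.\<close>

definition double_space :: "('k::field \<Rightarrow> 'a::ab_group_add \<Rightarrow> 'a) \<Rightarrow> ('a \<times> ('a \<Rightarrow> 'k)) set" where
  "double_space scale = UNIV \<times> dual_space scale"

definition double_scale ::
    "('k::field \<Rightarrow> 'a \<Rightarrow> 'a) \<Rightarrow> 'k \<Rightarrow> 'a \<times> ('a \<Rightarrow> 'k) \<Rightarrow> 'a \<times> ('a \<Rightarrow> 'k)" where
  "double_scale scale c = map_prod (scale c) (\<lambda>u v. c * u v)"

definition semidirect_mul ::
    "('a \<Rightarrow> 'a \<Rightarrow> 'a) \<Rightarrow> ('a \<Rightarrow> 'w \<Rightarrow> 'w) \<Rightarrow> 'a \<times> 'w \<Rightarrow> 'a \<times> 'w \<Rightarrow> 'a \<times> ('w::ab_group_add)" where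
  "semidirect_mul mul \<mu> = (\<lambda>(x, u) (y, v). (mul x y, \<mu> x v + \<mu> y u))"

definition semidirect_br ::
    "('a \<Rightarrow> 'a \<Rightarrow> 'a) \<Rightarrow> ('a \<Rightarrow> 'w \<Rightarrow> 'w) \<Rightarrow> 'a \<times> 'w \<Rightarrow> 'a \<times> 'w \<Rightarrow> 'a \<times> ('w::ab_group_add)" where
  "semidirect_br br \<rho> = (\<lambda>(x, u) (y, v). (br x y, \<rho> x v - \<rho> y u))"

end

theory Submission
  imports Defs
begin

text \<open>
  On the double \<open>D = A \<oplus> A\<^sup>*\<close> the form \<open>\<omega>(x + u, y + v) = v(x) - u(y)\<close> is symplectic, and \<open>r\<close> is the
  tensor inverse to it: contracting one leg of \<open>r\<close> with the functional \<open>\<omega>(-, X)\<close> leaves \<open>X\<close> or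
  \<open>-X\<close> (\<open>contract_left\<close>, \<open>contract_right\<close>). Three properties of \<open>\<omega>\<close> drive the proof:
  \<open>\<omega>(xy, z) + \<omega>(yz, x) + \<omega>(zx, y) = 0\<close>, the same cyclic identity for the bracket, and
  \<open>\<omega>(Px, y) = -\<omega>(x, Py)\<close>, where \<open>P\<close> is the derivation \<open>P - P\<^sup>*\<close> of the double. The map \<open>-P + P\<^sup>*\<close>
  is simply \<open>-P\<close> for this derivation.

  A tensor is zero as soon as all products of functionals vanish on it (\<open>tensor2_zeroI\<close>,
  \<open>tensor3_zeroI\<close>), and every functional on \<open>D\<close> is some \<open>\<omega>(-, X)\<close>. Tested in this way, both
  Yang-Baxter equations are the cyclic identities, and the coproducts become
  \<open>\<langle>\<Delta> u, X \<otimes> Y\<rangle> = \<omega>(u, X Y)\<close> and \<open>\<langle>\<delta> u, X \<otimes> Y\<rangle> = \<omega>(u, [X, Y])\<close> (\<open>pairing_\<Delta>\<close>, \<open>pairing_\<delta>\<close>):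
  under the identification of \<open>D\<close> with \<open>D\<^sup>*\<close> by \<open>\<omega>\<close> they are the transposes of the two products.
  Hence each axiom of a relative Poisson coalgebra is the transpose of the corresponding axiom of a
  relative Poisson algebra.

  The conditions on \<open>\<Delta>(P u)\<close> and \<open>\<delta>(P u)\<close> are transposes of the derivation property in the same way.
  For the rest \<open>\<omega>\<close> matters only through \<open>(P \<otimes> id - id \<otimes> Q) r = 0\<close>. For the map \<open>P\<close> of any relative
  Poisson algebra, \<open>-P\<close> is a dual representation (\<open>dually_represented_uminus\<close>), and the compatibility
  of coboundary coproducts with the products is a formal consequence of the algebra axioms, with
  the cyclic axiom of \<open>Q\<close> and that invariance of \<open>r\<close> entering in the case of \<open>\<delta>(x y)\<close>.

  It remains to see that the double is a relative Poisson algebra with these properties. Evaluated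
  at a vector, the axioms on the \<open>A\<^sup>*\<close> component say how \<open>x \<star> _\<close> and \<open>x \<circ> _\<close> compose: two of these
  rules are the Zinbiel and pre-Lie identities, the other two are \<open>circ_star\<close> and
  \<open>circ_dot_dual\<close>.
\<close>

section \<open>Tensors and multilinear functionals\<close>

text \<open>
  The linear extension of \<open>\<phi>\<close> to formal sums. It is used with \<open>\<phi>\<close> a product of linear functionals,
  one for each tensor factor; such a pairing respects equality of tensors.
\<close>

definition pairing :: "('b \<Rightarrow> 'k::field) \<Rightarrow> ('b \<Rightarrow>\<^sub>0 'k) \<Rightarrow> 'k" where
  "pairing \<phi> t = (\<Sum>b\<in>Poly_Mapping.keys t. Poly_Mapping.lookup t b * \<phi> b)"

lemma pairing_superset:
  "finite S \<Longrightarrow> Poly_Mapping.keys t \<subseteq> S \<Longrightarrow>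
    pairing \<phi> t = (\<Sum>b\<in>S. Poly_Mapping.lookup t b * \<phi> b)"
  unfolding pairing_def by (rule sum.mono_neutral_left) (auto simp: in_keys_iff)

lemma pairing_add [simp]: "pairing \<phi> (s + t) = pairing \<phi> s + pairing \<phi> t"
proof -
  let ?S = "Poly_Mapping.keys s \<union> Poly_Mapping.keys t"
  have "pairing \<phi> (s + t) = (\<Sum>b\<in>?S. Poly_Mapping.lookup (s + t) b * \<phi> b)"
    by (rule pairing_superset) (auto simp: keys_add)
  also have "\<dots> = (\<Sum>b\<in>?S. Poly_Mapping.lookup s b * \<phi> b) + (\<Sum>b\<in>?S. Poly_Mapping.lookup t b * \<phi> b)"
    by (simp add: lookup_add distrib_right sum.distrib)
  also have "\<dots> = pairing \<phi> s + pairing \<phi> t"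
    by (simp add: pairing_superset[symmetric])
  finally show ?thesis .
qed

lemma pairing_zero [simp]: "pairing \<phi> 0 = 0"
  by (simp add: pairing_def)

lemma pairing_single [simp]: "pairing \<phi> (Poly_Mapping.single b c) = c * \<phi> b"
  by (simp add: pairing_def)

lemma pairing_minus [simp]: "pairing \<phi> (- t) = - pairing \<phi> t"
  using pairing_add[of \<phi> t "- t"] by (simp add: eq_neg_iff_add_eq_0 add.commute)

lemma pairing_diff [simp]: "pairing \<phi> (s - t) = pairing \<phi> s - pairing \<phi> t"
  using pairing_add[of \<phi> s "- t"] by simp

lemma pairing_fscale [simp]: "pairing \<phi> (fscale c t) = c * pairing \<phi> t"
proof -
  have "pairing \<phi> (fscale c t) = (\<Sum>b\<in>Poly_Mapping.keys t. Poly_Mapping.lookup (fscale c t) b * \<phi> b)"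
    by (rule pairing_superset) (auto simp: in_keys_iff)
  then show ?thesis
    by (simp add: pairing_def sum_distrib_left mult.assoc)
qed

lemma pairing_sum [simp]: "pairing \<phi> (\<Sum>i\<in>I. t i) = (\<Sum>i\<in>I. pairing \<phi> (t i))"
  by (induction I rule: infinite_finite_induct) auto

lemma pairing_lin_ext: "pairing \<phi> (lin_ext f t) = pairing (\<lambda>b. pairing \<phi> (f b)) t"
  by (simp add: lin_ext_def) (simp add: pairing_def)

lemma pairing_tmap2 [simp]: "pairing \<phi> (tmap2 f g t) = pairing (\<lambda>(x, y). \<phi> (f x, g y)) t"
  by (simp add: tmap2_def pairing_lin_ext case_prod_unfold)

lemma pairing_tmap3 [simp]:
  "pairing \<phi> (tmap3 f g h t) = pairing (\<lambda>(x, y, z). \<phi> (f x, g y, h z)) t"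
  by (simp add: tmap3_def pairing_lin_ext case_prod_unfold)

lemma pairing_twist [simp]: "pairing \<phi> (twist t) = pairing (\<lambda>(x, y). \<phi> (y, x)) t"
  by (simp add: twist_def pairing_lin_ext case_prod_unfold)

lemma pairing_twist_id [simp]: "pairing \<phi> (twist_id t) = pairing (\<lambda>(x, y, z). \<phi> (y, x, z)) t"
  by (simp add: twist_id_def pairing_lin_ext case_prod_unfold)

lemma pairing_cyc [simp]: "pairing \<phi> (cyc t) = pairing (\<lambda>(x, y, z). \<phi> (y, z, x)) t"
  by (simp add: cyc_def pairing_lin_ext case_prod_unfold)

lemma pairing_id_tensor [simp]:
  "pairing \<phi> (id_tensor D t) = pairing (\<lambda>(x, y). pairing (\<lambda>(a, b). \<phi> (x, a, b)) (D y)) t"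
  by (simp add: id_tensor_def pairing_lin_ext case_prod_unfold)

lemma pairing_tensor_id [simp]:
  "pairing \<phi> (tensor_id D t) = pairing (\<lambda>(x, y). pairing (\<lambda>(a, b). \<phi> (a, b, y)) (D x)) t"
  by (simp add: tensor_id_def pairing_lin_ext case_prod_unfold)

lemma pairing_r12_r13:
  "pairing \<phi> (r12_r13 m r) =
    pairing (\<lambda>(a, b). pairing (\<lambda>(a', b'). \<phi> (m a a', b, b')) r) r"
  by (simp add: r12_r13_def pairing_lin_ext case_prod_unfold)

lemma pairing_r12_r23:
  "pairing \<phi> (r12_r23 m r) =
    pairing (\<lambda>(a, b). pairing (\<lambda>(a', b'). \<phi> (a, m b a', b')) r) r"
  by (simp add: r12_r23_def pairing_lin_ext case_prod_unfold)

lemma pairing_r13_r23: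
  "pairing \<phi> (r13_r23 m r) =
    pairing (\<lambda>(a, b). pairing (\<lambda>(a', b'). \<phi> (a, a', m b b')) r) r"
  by (simp add: r13_r23_def pairing_lin_ext case_prod_unfold)

lemma pairing_fun_add: "pairing (\<lambda>b. \<phi> b + \<psi> b) t = pairing \<phi> t + pairing \<psi> t"
  by (simp add: pairing_def distrib_left sum.distrib)

lemma pairing_fun_diff: "pairing (\<lambda>b. \<phi> b - \<psi> b) t = pairing \<phi> t - pairing \<psi> t"
  by (simp add: pairing_def right_diff_distrib sum_subtractf)

lemma pairing_fun_minus: "pairing (\<lambda>b. - \<phi> b) t = - pairing \<phi> t"
  by (simp add: pairing_def sum_negf)

lemma pairing_fun_scale: "pairing (\<lambda>b. c * \<phi> b) t = c * pairing \<phi> t"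
  by (simp add: pairing_def sum_distrib_left mult.left_commute)

lemma pairing_cong:
  "Poly_Mapping.keys t \<subseteq> S \<Longrightarrow> (\<And>b. b \<in> S \<Longrightarrow> \<phi> b = \<psi> b) \<Longrightarrow> pairing \<phi> t = pairing \<psi> t"
  unfolding pairing_def by (rule sum.cong) auto

lemma pairing_cong2:
  assumes "t \<in> tensor2_space V" "\<And>x y. x \<in> V \<Longrightarrow> y \<in> V \<Longrightarrow> \<phi> (x, y) = \<psi> (x, y)"
  shows "pairing \<phi> t = pairing \<psi> t"
  by (rule pairing_cong[of t "V \<times> V"]) (use assms in \<open>auto simp: tensor2_space_def\<close>)

text \<open>
  Read from right to left, linearity in the functional merges several pairings with the same tensor
  into a single one, so that an identity between them can be checked on pure tensors.
\<close>

lemmas pairing_collect = pairing_fun_add[symmetric] pairing_fun_diff[symmetric]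
  pairing_fun_minus[symmetric] pairing_fun_scale[symmetric]

text \<open>
  Functionals only detect equality of formal sums of elements of the carrier, since the relations
  involve no others. The closure lemmas below keep track of this for all operations on tensors.
\<close>

definition tensor3_space :: "'v set \<Rightarrow> ('v \<times> 'v \<times> 'v \<Rightarrow>\<^sub>0 'k::field) set" where
  "tensor3_space V = {t. Poly_Mapping.keys t \<subseteq> V \<times> V \<times> V}"

lemma keys_sum_subset:
  "(\<And>i. i \<in> I \<Longrightarrow> Poly_Mapping.keys (f i) \<subseteq> S) \<Longrightarrow> Poly_Mapping.keys (\<Sum>i\<in>I. f i) \<subseteq> S"
proof (induction I rule: infinite_finite_induct)
  case (insert i I)
  then show ?case using keys_add[of "f i" "sum f I"] by auto
qed auto

lemma keys_lin_ext_subset: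
  assumes "Poly_Mapping.keys t \<subseteq> S" "\<And>b. b \<in> S \<Longrightarrow> Poly_Mapping.keys (f b) \<subseteq> T"
  shows "Poly_Mapping.keys (lin_ext f t) \<subseteq> T"
  unfolding lin_ext_def
proof (rule keys_sum_subset)
  fix b assume "b \<in> Poly_Mapping.keys t"
  then have "Poly_Mapping.keys (f b) \<subseteq> T" using assms by auto
  then show "Poly_Mapping.keys (fscale (Poly_Mapping.lookup t b) (f b)) \<subseteq> T"
    by (auto simp: in_keys_iff)
qed

lemma tensor2_space_closed [intro]:
  "0 \<in> tensor2_space V"
  "s \<in> tensor2_space V \<Longrightarrow> t \<in> tensor2_space V \<Longrightarrow> s + t \<in> tensor2_space V"
  "s \<in> tensor2_space V \<Longrightarrow> t \<in> tensor2_space V \<Longrightarrow> s - t \<in> tensor2_space V"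
  "t \<in> tensor2_space V \<Longrightarrow> - t \<in> tensor2_space V"
  "t \<in> tensor2_space V \<Longrightarrow> fscale c t \<in> tensor2_space V"
  "x \<in> V \<Longrightarrow> y \<in> V \<Longrightarrow> pure2 x y \<in> tensor2_space V"
  unfolding tensor2_space_def mem_Collect_eq
  subgoal by simp
  subgoal using keys_add[of s t] by blast
  subgoal using keys_diff[of s t] by blast
  subgoal by simp
  subgoal by (auto simp: in_keys_iff)
  subgoal by simp
  done

lemma tensor3_space_closed [intro]:
  "s \<in> tensor3_space V \<Longrightarrow> t \<in> tensor3_space V \<Longrightarrow> s + t \<in> tensor3_space V"
  "s \<in> tensor3_space V \<Longrightarrow> t \<in> tensor3_space V \<Longrightarrow> s - t \<in> tensor3_space V"
  unfolding tensor3_space_def mem_Collect_eq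
  subgoal using keys_add[of s t] by blast
  subgoal using keys_diff[of s t] by blast
  done

lemma tensor2_space_sum:
  "(\<And>i. i \<in> I \<Longrightarrow> f i \<in> tensor2_space V) \<Longrightarrow> (\<Sum>i\<in>I. f i) \<in> tensor2_space V"
  unfolding tensor2_space_def mem_Collect_eq by (rule keys_sum_subset)

lemma tmap2_closed [intro]:
  "t \<in> tensor2_space V \<Longrightarrow> (\<And>x. x \<in> V \<Longrightarrow> f x \<in> V) \<Longrightarrow> (\<And>x. x \<in> V \<Longrightarrow> g x \<in> V) \<Longrightarrow>
    tmap2 f g t \<in> tensor2_space V"
  unfolding tensor2_space_def tmap2_def
  by (rule CollectI, rule keys_lin_ext_subset[of _ "V \<times> V"]) auto

lemma tmap3_closed [intro]:
  "t \<in> tensor3_space V \<Longrightarrow> (\<And>x. x \<in> V \<Longrightarrow> f x \<in> V) \<Longrightarrow> (\<And>x. x \<in> V \<Longrightarrow> g x \<in> V) \<Longrightarrow>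
    (\<And>x. x \<in> V \<Longrightarrow> h x \<in> V) \<Longrightarrow> tmap3 f g h t \<in> tensor3_space V"
  unfolding tensor3_space_def tmap3_def
  by (rule CollectI, rule keys_lin_ext_subset[of _ "V \<times> V \<times> V"]) auto

lemma twist_closed [intro]: "t \<in> tensor2_space V \<Longrightarrow> twist t \<in> tensor2_space V"
  unfolding tensor2_space_def twist_def
  by (rule CollectI, rule keys_lin_ext_subset[of _ "V \<times> V"]) auto

lemma twist_id_closed [intro]: "t \<in> tensor3_space V \<Longrightarrow> twist_id t \<in> tensor3_space V"
  unfolding tensor3_space_def twist_id_def
  by (rule CollectI, rule keys_lin_ext_subset[of _ "V \<times> V \<times> V"]) auto

lemma cyc_closed [intro]: "t \<in> tensor3_space V \<Longrightarrow> cyc t \<in> tensor3_space V"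
  unfolding tensor3_space_def cyc_def
  by (rule CollectI, rule keys_lin_ext_subset[of _ "V \<times> V \<times> V"]) auto

lemma id_tensor_closed [intro]:
  assumes t: "t \<in> tensor2_space V" and D: "\<And>x. x \<in> V \<Longrightarrow> D x \<in> tensor2_space V"
  shows "id_tensor D t \<in> tensor3_space V"
proof -
  have "Poly_Mapping.keys (lin_ext (\<lambda>(a, b). pure3 x a b) (D y)) \<subseteq> V \<times> V \<times> V"
    if "x \<in> V" "y \<in> V" for x y
    by (rule keys_lin_ext_subset[of _ "V \<times> V"]) (use that D[of y] in \<open>auto simp: tensor2_space_def\<close>)
  then have "Poly_Mapping.keys (id_tensor D t) \<subseteq> V \<times> V \<times> V"
    unfolding id_tensor_def
    by (intro keys_lin_ext_subset[of t "V \<times> V"]) (use t in \<open>simp_all add: tensor2_space_def split_beta mem_Times_iff\<close>)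
  then show ?thesis by (simp add: tensor3_space_def)
qed

lemma tensor_id_closed [intro]:
  assumes t: "t \<in> tensor2_space V" and D: "\<And>x. x \<in> V \<Longrightarrow> D x \<in> tensor2_space V"
  shows "tensor_id D t \<in> tensor3_space V"
proof -
  have "Poly_Mapping.keys (lin_ext (\<lambda>(a, b). pure3 a b y) (D x)) \<subseteq> V \<times> V \<times> V"
    if "x \<in> V" "y \<in> V" for x y
    by (rule keys_lin_ext_subset[of _ "V \<times> V"]) (use that D[of x] in \<open>auto simp: tensor2_space_def\<close>)
  then have "Poly_Mapping.keys (tensor_id D t) \<subseteq> V \<times> V \<times> V"
    unfolding tensor_id_def
    by (intro keys_lin_ext_subset[of t "V \<times> V"]) (use t in \<open>simp_all add: tensor2_space_def split_beta mem_Times_iff\<close>)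
  then show ?thesis by (simp add: tensor3_space_def)
qed

lemma keys_double_lin_ext_subset:
  assumes r: "r \<in> tensor2_space V"
    and F: "\<And>a b a' b'. a \<in> V \<Longrightarrow> b \<in> V \<Longrightarrow> a' \<in> V \<Longrightarrow> b' \<in> V \<Longrightarrow>
      Poly_Mapping.keys (F a b a' b') \<subseteq> T"
  shows "Poly_Mapping.keys (lin_ext (\<lambda>(a, b). lin_ext (\<lambda>(a', b'). F a b a' b') r) r) \<subseteq> T"
proof -
  have "Poly_Mapping.keys (lin_ext (\<lambda>(a', b'). F a b a' b') r) \<subseteq> T" if "a \<in> V" "b \<in> V" for a b
    by (intro keys_lin_ext_subset[of r "V \<times> V"])
       (use that r F in \<open>simp_all add: tensor2_space_def split_beta mem_Times_iff\<close>)
  then show ?thesis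
    by (intro keys_lin_ext_subset[of r "V \<times> V"])
       (use r in \<open>simp_all add: tensor2_space_def split_beta mem_Times_iff\<close>)
qed

lemma r_products_closed [intro]:
  assumes "r \<in> tensor2_space V" "\<And>x y. x \<in> V \<Longrightarrow> y \<in> V \<Longrightarrow> m x y \<in> V"
  shows "r12_r13 m r \<in> tensor3_space V" "r12_r23 m r \<in> tensor3_space V"
    "r13_r23 m r \<in> tensor3_space V"
  unfolding tensor3_space_def r12_r13_def r12_r23_def r13_r23_def mem_Collect_eq
  by (rule keys_double_lin_ext_subset[OF assms(1)], use assms(2) in simp)+

definition linear_functional ::
    "('k::field \<Rightarrow> 'v::ab_group_add \<Rightarrow> 'v) \<Rightarrow> 'v set \<Rightarrow> ('v \<Rightarrow> 'k) \<Rightarrow> bool" where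
  "linear_functional scale V f \<longleftrightarrow>
     (\<forall>x\<in>V. \<forall>y\<in>V. f (x + y) = f x + f y) \<and> (\<forall>c. \<forall>x\<in>V. f (scale c x) = c * f x)"

text \<open>
  One tensor factor is expanded at a time: \<open>T\<close> inserts a vector into one slot of a pure tensor whose
  other entries are held fixed.
\<close>

lemma multilinear_slot_sum:
  fixes scale :: "'k::field \<Rightarrow> 'v::ab_group_add \<Rightarrow> 'v" and T :: "'v \<Rightarrow> ('c \<Rightarrow>\<^sub>0 'k)"
  assumes vs: "vector_space scale" and V: "module.subspace scale V"
    and add: "\<And>x y. x \<in> V \<Longrightarrow> y \<in> V \<Longrightarrow> T (x + y) - T x - T y \<in> fsum.span R"
    and sc: "\<And>c x. x \<in> V \<Longrightarrow> T (scale c x) - fscale c (T x) \<in> fsum.span R"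
    and B: "B \<subseteq> V" and x: "x = (\<Sum>b\<in>B. scale (c b) b)"
  shows "T x - (\<Sum>b\<in>B. fscale (c b) (T b)) \<in> fsum.span R"
proof -
  interpret vector_space scale by fact
  have zero: "T 0 \<in> fsum.span R"
    using sc[of 0 0] subspace_0[OF V] by simp
  have "T (\<Sum>b\<in>B. scale (c b) b) - (\<Sum>b\<in>B. fscale (c b) (T b)) \<in> fsum.span R" using B
  proof (induction B rule: infinite_finite_induct)
    case (insert b B)
    let ?s = "\<Sum>b\<in>B. scale (c b) b"
    have s: "?s \<in> V" and b: "b \<in> V"
      using insert.prems by (auto intro!: subspace_sum[OF V] subspace_scale[OF V])
    have "T (\<Sum>b\<in>insert b B. scale (c b) b) - (\<Sum>b\<in>insert b B. fscale (c b) (T b)) =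
        (T (scale (c b) b + ?s) - T (scale (c b) b) - T ?s)
        + (T (scale (c b) b) - fscale (c b) (T b))
        + (T ?s - (\<Sum>b\<in>B. fscale (c b) (T b)))"
      using insert.hyps by simp
    also have "\<dots> \<in> fsum.span R"
      by (intro fsum.span_add add sc s b subspace_scale[OF V] insert.IH) (use insert.prems in auto)
    finally show ?case .
  qed (use zero in simp_all)
  then show ?thesis by (simp add: x)
qed

text \<open>
  Modulo the relations, \<open>t\<close> is the combination of the finitely many tensors \<open>E j\<close> with coefficients
  \<open>pairing (c j) t\<close>.
\<close>

lemma tensor_zeroI:
  fixes t :: "'b \<Rightarrow>\<^sub>0 'k::field"
  assumes t: "Poly_Mapping.keys t \<subseteq> S" and J: "finite J"
    and exp: "\<And>b. b \<in> S \<Longrightarrow>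
      Poly_Mapping.single b 1 - (\<Sum>j\<in>J. fscale (c j b) (E j)) \<in> fsum.span R"
    and zero: "\<And>j. j \<in> J \<Longrightarrow> pairing (c j) t = 0"
  shows "t \<in> fsum.span R"
proof -
  let ?K = "Poly_Mapping.keys t" and ?l = "Poly_Mapping.lookup t"
  have t_sum: "t = (\<Sum>b\<in>?K. fscale (?l b) (Poly_Mapping.single b 1))"
    by (rule poly_mapping_eqI)
       (simp add: lookup_sum lookup_single when_def in_keys_iff if_distrib cong: if_cong)
  have "(\<Sum>b\<in>?K. fscale (?l b) (\<Sum>j\<in>J. fscale (c j b) (E j))) =
      (\<Sum>j\<in>J. fscale (pairing (c j) t) (E j))"
    by (simp add: fsum.scale_sum_right fsum.scale_sum_left pairing_def)
       (rule sum.swap)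
  also have "\<dots> = 0" by (simp add: zero)
  finally have "t = (\<Sum>b\<in>?K. fscale (?l b) (Poly_Mapping.single b 1))
      - (\<Sum>b\<in>?K. fscale (?l b) (\<Sum>j\<in>J. fscale (c j b) (E j)))"
    using t_sum by simp
  also have "\<dots> = (\<Sum>b\<in>?K. fscale (?l b)
      (Poly_Mapping.single b 1 - (\<Sum>j\<in>J. fscale (c j b) (E j))))"
    by (simp add: fsum.scale_right_diff_distrib sum_subtractf)
  also have "\<dots> \<in> fsum.span R"
    using t by (intro fsum.span_sum fsum.span_scale exp) auto
  finally show ?thesis .
qed

context fd_space
begin

lemma coordinates:
  obtains B c where "finite B" "B \<subseteq> V" "\<And>b. b \<in> B \<Longrightarrow> linear_functional scale V (c b)"
    "\<And>x. x \<in> V \<Longrightarrow> x = (\<Sum>b\<in>B. scale (c b x) b)"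
proof -
  obtain S where S: "finite S" "span S = V" using finite_dim by auto
  obtain B where B: "B \<subseteq> V" "independent B" "V \<subseteq> span B"
    using maximal_independent_subset[of V] by metis
  have fin: "finite B"
    using independent_span_bound[OF S(1) B(2)] B(1) S(2) by auto
  let ?c = "\<lambda>b x. representation B x b"
  show ?thesis
  proof
    show "linear_functional scale V (?c b)" for b
      unfolding linear_functional_def
      using B by (auto simp: representation_add representation_scale subset_iff)
    show "x = (\<Sum>b\<in>B. scale (?c b x) b)" if "x \<in> V" for x
      using sum_representation_eq[OF B(2) _ fin order_refl, of x] that B(3) by auto
  qed (use fin B in auto)
qed

lemma pure2_relations:
  "x \<in> V \<Longrightarrow> x' \<in> V \<Longrightarrow> y \<in> V \<Longrightarrow>
    pure2 (x + x') y - pure2 x y - pure2 x' y \<in> fsum.span (bilinear_relations scale V)"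
  "x \<in> V \<Longrightarrow> y \<in> V \<Longrightarrow> y' \<in> V \<Longrightarrow>
    pure2 x (y + y') - pure2 x y - pure2 x y' \<in> fsum.span (bilinear_relations scale V)"
  "x \<in> V \<Longrightarrow> y \<in> V \<Longrightarrow>
    pure2 (scale c x) y - fscale c (pure2 x y) \<in> fsum.span (bilinear_relations scale V)"
  "x \<in> V \<Longrightarrow> y \<in> V \<Longrightarrow>
    pure2 x (scale c y) - fscale c (pure2 x y) \<in> fsum.span (bilinear_relations scale V)"
  unfolding bilinear_relations_def by (rule fsum.span_base, blast)+

lemma pure3_relations:
  assumes "x \<in> V" "x' \<in> V" "y \<in> V" "y' \<in> V" "z \<in> V" "z' \<in> V"
  shows
  "pure3 (x + x') y z - pure3 x y z - pure3 x' y z \<in> fsum.span (trilinear_relations scale V)"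
  "pure3 x (y + y') z - pure3 x y z - pure3 x y' z \<in> fsum.span (trilinear_relations scale V)"
  "pure3 x y (z + z') - pure3 x y z - pure3 x y z' \<in> fsum.span (trilinear_relations scale V)"
  "pure3 (scale c x) y z - fscale c (pure3 x y z) \<in> fsum.span (trilinear_relations scale V)"
  "pure3 x (scale c y) z - fscale c (pure3 x y z) \<in> fsum.span (trilinear_relations scale V)"
  "pure3 x y (scale c z) - fscale c (pure3 x y z) \<in> fsum.span (trilinear_relations scale V)"
  unfolding trilinear_relations_def
  subgoal by (rule fsum.span_base, rule UnI1, rule UnI1, rule UnI1, rule UnI1, rule UnI1, use assms in blast)
  subgoal by (rule fsum.span_base, rule UnI1, rule UnI1, rule UnI1, rule UnI1, rule UnI2, use assms in blast)
  subgoal by (rule fsum.span_base, rule UnI1, rule UnI1, rule UnI1, rule UnI2, use assms in blast)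
  subgoal by (rule fsum.span_base, rule UnI1, rule UnI1, rule UnI2, use assms in blast)
  subgoal by (rule fsum.span_base, rule UnI1, rule UnI2, use assms in blast)
  subgoal by (rule fsum.span_base, rule UnI2, use assms in blast)
  done

text \<open>
  Expanding both factors in a basis of the carrier turns a tensor into the combination of the tensors
  of basis vectors whose coefficients are its values on products of coordinate functionals.
\<close>

theorem tensor2_zeroI:
  assumes t: "t \<in> tensor2_space V"
    and zero: "\<And>f g. linear_functional scale V f \<Longrightarrow> linear_functional scale V g \<Longrightarrow>
      pairing (\<lambda>(x, y). f x * g y) t = 0"
  shows "t \<approx>\<^sub>2 0"
proof -
  obtain B c where B: "finite B" "B \<subseteq> V" "\<And>b. b \<in> B \<Longrightarrow> linear_functional scale V (c b)"
    and exp: "\<And>x. x \<in> V \<Longrightarrow> x = (\<Sum>b\<in>B. scale (c b x) b)"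
    using coordinates by blast
  let ?R = "bilinear_relations scale V"
  have "t \<in> fsum.span ?R"
  proof (rule tensor_zeroI[where S = "V \<times> V" and J = "B \<times> B" and R = ?R
        and c = "\<lambda>(a, b) (x, y). c a x * c b y" and E = "\<lambda>(a, b). pure2 a b"])
    show "Poly_Mapping.keys t \<subseteq> V \<times> V" using t by (simp add: tensor2_space_def)
    show "finite (B \<times> B)" using B by simp
    show "pairing ((\<lambda>(a, b) (x, y). c a x * c b y) j) t = 0" if "j \<in> B \<times> B" for j
      using that zero[OF B(3) B(3)] by auto
    fix s assume "s \<in> V \<times> V"
    then obtain x y where s: "s = (x, y)" "x \<in> V" "y \<in> V" by auto
    have 1: "pure2 x y - (\<Sum>a\<in>B. fscale (c a x) (pure2 a y)) \<in> fsum.span ?R"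
      by (rule multilinear_slot_sum[OF vector_space_axioms subspace_carrier,
            where T = "\<lambda>x. pure2 x y" and c = "\<lambda>b. c b x"])
         (use B s exp in \<open>auto intro: pure2_relations\<close>)
    have 2: "pure2 a y - (\<Sum>b\<in>B. fscale (c b y) (pure2 a b)) \<in> fsum.span ?R" if "a \<in> B" for a
      by (rule multilinear_slot_sum[OF vector_space_axioms subspace_carrier,
            where T = "\<lambda>y. pure2 a y" and c = "\<lambda>b. c b y"])
         (use B s that exp in \<open>auto intro: pure2_relations\<close>)
    have "pure2 x y - (\<Sum>(a, b)\<in>B \<times> B. fscale (c a x * c b y) (pure2 a b)) =
        (pure2 x y - (\<Sum>a\<in>B. fscale (c a x) (pure2 a y)))
        + (\<Sum>a\<in>B. fscale (c a x) (pure2 a y - (\<Sum>b\<in>B. fscale (c b y) (pure2 a b))))"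
      by (simp add: sum.cartesian_product[symmetric] fsum.scale_right_diff_distrib
          sum_subtractf fsum.scale_sum_right)
    also have "\<dots> \<in> fsum.span ?R"
      by (intro fsum.span_add 1 fsum.span_sum fsum.span_scale 2)
    finally show "Poly_Mapping.single s 1
        - (\<Sum>j\<in>B \<times> B. fscale ((\<lambda>(a, b) (x, y). c a x * c b y) j s) ((\<lambda>(a, b). pure2 a b) j))
        \<in> fsum.span ?R"
      by (simp add: s case_prod_unfold)
  qed
  then show ?thesis by (simp add: tensor2_eq_def)
qed

theorem tensor3_zeroI:
  assumes t: "t \<in> tensor3_space V"
    and zero: "\<And>f g h. linear_functional scale V f \<Longrightarrow> linear_functional scale V g \<Longrightarrow>
      linear_functional scale V h \<Longrightarrow> pairing (\<lambda>(x, y, z). f x * g y * h z) t = 0"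
  shows "t \<approx>\<^sub>3 0"
proof -
  obtain B c where B: "finite B" "B \<subseteq> V" "\<And>b. b \<in> B \<Longrightarrow> linear_functional scale V (c b)"
    and exp: "\<And>x. x \<in> V \<Longrightarrow> x = (\<Sum>b\<in>B. scale (c b x) b)"
    using coordinates by blast
  let ?R = "trilinear_relations scale V"
  have "t \<in> fsum.span ?R"
  proof (rule tensor_zeroI[where S = "V \<times> V \<times> V" and J = "B \<times> B \<times> B" and R = ?R
        and c = "\<lambda>(a, b, d) (x, y, z). c a x * c b y * c d z" and E = "\<lambda>(a, b, d). pure3 a b d"])
    show "Poly_Mapping.keys t \<subseteq> V \<times> V \<times> V" using t by (simp add: tensor3_space_def)
    show "finite (B \<times> B \<times> B)" using B by simp
    show "pairing ((\<lambda>(a, b, d) (x, y, z). c a x * c b y * c d z) j) t = 0"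
      if "j \<in> B \<times> B \<times> B" for j
      using that zero[OF B(3) B(3) B(3)] by auto
    fix s assume "s \<in> V \<times> V \<times> V"
    then obtain x y z where s: "s = (x, y, z)" "x \<in> V" "y \<in> V" "z \<in> V" by auto
    have 1: "pure3 x y z - (\<Sum>a\<in>B. fscale (c a x) (pure3 a y z)) \<in> fsum.span ?R"
      by (rule multilinear_slot_sum[OF vector_space_axioms subspace_carrier,
            where T = "\<lambda>x. pure3 x y z" and c = "\<lambda>b. c b x"])
         (use B s exp in \<open>auto intro: pure3_relations\<close>)
    have 2: "pure3 a y z - (\<Sum>b\<in>B. fscale (c b y) (pure3 a b z)) \<in> fsum.span ?R" if "a \<in> B" for a
      by (rule multilinear_slot_sum[OF vector_space_axioms subspace_carrier,
            where T = "\<lambda>y. pure3 a y z" and c = "\<lambda>b. c b y"])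
         (use B s that exp in \<open>auto intro: pure3_relations\<close>)
    have 3: "pure3 a b z - (\<Sum>d\<in>B. fscale (c d z) (pure3 a b d)) \<in> fsum.span ?R"
      if "a \<in> B" "b \<in> B" for a b
      by (rule multilinear_slot_sum[OF vector_space_axioms subspace_carrier,
            where T = "\<lambda>z. pure3 a b z" and c = "\<lambda>b. c b z"])
         (use B s that exp in \<open>auto intro: pure3_relations\<close>)
    have "pure3 x y z - (\<Sum>(a, b, d)\<in>B \<times> B \<times> B. fscale (c a x * c b y * c d z) (pure3 a b d)) =
        (pure3 x y z - (\<Sum>a\<in>B. fscale (c a x) (pure3 a y z)))
        + (\<Sum>a\<in>B. fscale (c a x) (pure3 a y z - (\<Sum>b\<in>B. fscale (c b y) (pure3 a b z))))
        + (\<Sum>a\<in>B. fscale (c a x) (\<Sum>b\<in>B. fscale (c b y)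
            (pure3 a b z - (\<Sum>d\<in>B. fscale (c d z) (pure3 a b d)))))"
      by (simp add: sum.cartesian_product[symmetric] fsum.scale_right_diff_distrib
          sum_subtractf fsum.scale_sum_right mult.assoc)
    also have "\<dots> \<in> fsum.span ?R"
      by (intro fsum.span_add 1 fsum.span_sum fsum.span_scale 2 3)
    finally show "Poly_Mapping.single s 1
        - (\<Sum>j\<in>B \<times> B \<times> B. fscale ((\<lambda>(a, b, d) (x, y, z). c a x * c b y * c d z) j s)
            ((\<lambda>(a, b, d). pure3 a b d) j))
        \<in> fsum.span ?R"
      by (simp add: s case_prod_unfold)
  qed
  then show ?thesis by (simp add: tensor3_eq_def)
qed

lemma pairing_tensor2_eq:
  assumes "s \<approx>\<^sub>2 t" and f: "linear_functional scale V f" and g: "linear_functional scale V g"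
  shows "pairing (\<lambda>(x, y). f x * g y) s = pairing (\<lambda>(x, y). f x * g y) t"
proof -
  let ?\<phi> = "\<lambda>(x, y). f x * g y"
  have "s - t \<in> fsum.span (bilinear_relations scale V)" using assms(1) by (simp add: tensor2_eq_def)
  then have "pairing ?\<phi> (s - t) = 0"
  proof (induction rule: fsum.span_induct_alt)
    case (step c u v)
    have "pairing ?\<phi> u = 0"
      using step(1) f g unfolding bilinear_relations_def linear_functional_def Un_iff mem_Collect_eq
      by (elim disjE exE conjE; hypsubst; simp add: algebra_simps)
    then show ?case using step by simp
  qed simp
  then show ?thesis by simp
qed

lemma tensor2_eqI:
  assumes "s \<in> tensor2_space V" "t \<in> tensor2_space V"
    and "\<And>f g. linear_functional scale V f \<Longrightarrow> linear_functional scale V g \<Longrightarrow>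
      pairing (\<lambda>(x, y). f x * g y) s = pairing (\<lambda>(x, y). f x * g y) t"
  shows "s \<approx>\<^sub>2 t"
proof -
  have "s - t \<approx>\<^sub>2 0" by (rule tensor2_zeroI) (use assms in auto)
  then show ?thesis by (simp add: tensor2_eq_def)
qed

lemma tensor3_eqI:
  assumes "s \<in> tensor3_space V" "t \<in> tensor3_space V"
    and "\<And>f g h. linear_functional scale V f \<Longrightarrow> linear_functional scale V g \<Longrightarrow>
      linear_functional scale V h \<Longrightarrow>
      pairing (\<lambda>(x, y, z). f x * g y * h z) s = pairing (\<lambda>(x, y, z). f x * g y * h z) t"
  shows "s \<approx>\<^sub>3 t"
proof -
  have "s - t \<approx>\<^sub>3 0" by (rule tensor3_zeroI) (use assms in auto)
  then show ?thesis by (simp add: tensor3_eq_def)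
qed

end

section \<open>Coboundary coproducts\<close>

context fd_space
begin

lemma linear_functionalD:
  assumes "linear_functional scale V f"
  shows "x \<in> V \<Longrightarrow> y \<in> V \<Longrightarrow> f (x + y) = f x + f y"
    "x \<in> V \<Longrightarrow> y \<in> V \<Longrightarrow> f (x - y) = f x - f y"
    "x \<in> V \<Longrightarrow> f (scale c x) = c * f x"
    "x \<in> V \<Longrightarrow> f (- x) = - f x"
proof -
  have add: "\<And>x y. x \<in> V \<Longrightarrow> y \<in> V \<Longrightarrow> f (x + y) = f x + f y"
    and sc: "\<And>c x. x \<in> V \<Longrightarrow> f (scale c x) = c * f x"
    using assms by (auto simp: linear_functional_def)
  show "x \<in> V \<Longrightarrow> y \<in> V \<Longrightarrow> f (x + y) = f x + f y" "x \<in> V \<Longrightarrow> f (scale c x) = c * f x"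
    using add sc by auto
  have minus: "\<And>x. x \<in> V \<Longrightarrow> f (- x) = - f x" using sc[of _ "-1"] by simp
  then show "x \<in> V \<Longrightarrow> f (- x) = - f x" by simp
  show "x \<in> V \<Longrightarrow> y \<in> V \<Longrightarrow> f (x - y) = f x - f y"
    using add[of x "- y"] minus[of y] subspace_neg[OF subspace_carrier] by simp
qed

lemma linear_functional_zero: "linear_functional scale V f \<Longrightarrow> f 0 = 0"
  using linear_functionalD(3)[of f 0 0] subspace_0[OF subspace_carrier] by simp

lemma linear_functional_sum:
  assumes "linear_functional scale V f" "\<And>i. i \<in> I \<Longrightarrow> x i \<in> V"
  shows "f (\<Sum>i\<in>I. x i) = (\<Sum>i\<in>I. f (x i))"
  using assms(2)
proof (induction I rule: infinite_finite_induct)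
  case (insert i I)
  then show ?case
    using linear_functionalD(1)[OF assms(1), of "x i" "sum x I"]
      subspace_sum[OF subspace_carrier, of I x] by simp
qed (simp_all add: linear_functional_zero[OF assms(1)])

lemma linear_endoD:
  assumes "linear_endo scale V f"
  shows "x \<in> V \<Longrightarrow> f x \<in> V"
    "x \<in> V \<Longrightarrow> y \<in> V \<Longrightarrow> f (x + y) = f x + f y"
    "x \<in> V \<Longrightarrow> y \<in> V \<Longrightarrow> f (x - y) = f x - f y"
    "x \<in> V \<Longrightarrow> f (scale c x) = scale c (f x)"
    "x \<in> V \<Longrightarrow> f (- x) = - f x"
proof -
  have add: "\<And>x y. x \<in> V \<Longrightarrow> y \<in> V \<Longrightarrow> f (x + y) = f x + f y"
    and sc: "\<And>c x. x \<in> V \<Longrightarrow> f (scale c x) = scale c (f x)"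
    using assms by (auto simp: linear_endo_def)
  show "x \<in> V \<Longrightarrow> y \<in> V \<Longrightarrow> f (x + y) = f x + f y"
    "x \<in> V \<Longrightarrow> f (scale c x) = scale c (f x)" "x \<in> V \<Longrightarrow> f x \<in> V"
    using add sc assms by (auto simp: linear_endo_def)
  have minus: "\<And>x. x \<in> V \<Longrightarrow> f (- x) = - f x" using sc[of _ "-1"] by simp
  then show "x \<in> V \<Longrightarrow> f (- x) = - f x" by simp
  show "x \<in> V \<Longrightarrow> y \<in> V \<Longrightarrow> f (x - y) = f x - f y"
    using add[of x "- y"] minus[of y] subspace_neg[OF subspace_carrier] by simp
qed

lemma linear_functional_compose:
  "linear_functional scale V f \<Longrightarrow> linear_endo scale V h \<Longrightarrow> linear_functional scale V (\<lambda>x. f (h x))"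
  by (simp add: linear_functional_def linear_endo_def)

lemma carrier_closed [simp]:
  "0 \<in> V"
  "x \<in> V \<Longrightarrow> y \<in> V \<Longrightarrow> x + y \<in> V"
  "x \<in> V \<Longrightarrow> y \<in> V \<Longrightarrow> x - y \<in> V"
  "x \<in> V \<Longrightarrow> - x \<in> V"
  "x \<in> V \<Longrightarrow> scale c x \<in> V"
  using subspace_0[OF subspace_carrier] subspace_add[OF subspace_carrier]
    subspace_diff[OF subspace_carrier] subspace_neg[OF subspace_carrier]
    subspace_scale[OF subspace_carrier] by auto

lemma bilinear_opD:
  assumes "bilinear_op scale V m"
  shows "x \<in> V \<Longrightarrow> y \<in> V \<Longrightarrow> m x y \<in> V"
    "x \<in> V \<Longrightarrow> y \<in> V \<Longrightarrow> z \<in> V \<Longrightarrow> m (x + y) z = m x z + m y z"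
    "x \<in> V \<Longrightarrow> y \<in> V \<Longrightarrow> z \<in> V \<Longrightarrow> m (x - y) z = m x z - m y z"
    "x \<in> V \<Longrightarrow> z \<in> V \<Longrightarrow> m (scale c x) z = scale c (m x z)"
    "x \<in> V \<Longrightarrow> z \<in> V \<Longrightarrow> m (- x) z = - m x z"
    "x \<in> V \<Longrightarrow> y \<in> V \<Longrightarrow> z \<in> V \<Longrightarrow> m z (x + y) = m z x + m z y"
    "x \<in> V \<Longrightarrow> y \<in> V \<Longrightarrow> z \<in> V \<Longrightarrow> m z (x - y) = m z x - m z y"
    "x \<in> V \<Longrightarrow> z \<in> V \<Longrightarrow> m z (scale c x) = scale c (m z x)"
    "x \<in> V \<Longrightarrow> z \<in> V \<Longrightarrow> m z (- x) = - m z x"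
  using assms linear_endoD[of "m z"] linear_endoD[of "m x"] linear_endoD[of "\<lambda>x. m x z"]
  unfolding bilinear_op_def by auto

end

context relative_poisson_algebra
begin

lemmas mul_simps [simp] = bilinear_opD[OF mul_bilinear]
lemmas br_simps [simp] = bilinear_opD[OF br_bilinear]
lemmas P_simps [simp] = linear_endoD[OF P_linear]

lemma P_mul: "x \<in> V \<Longrightarrow> y \<in> V \<Longrightarrow> P (mul x y) = mul (P x) y + mul x (P y)"
  using P_derivation_mul by (simp add: derivation_of_def)

lemma P_br: "x \<in> V \<Longrightarrow> y \<in> V \<Longrightarrow> P (br x y) = br (P x) y + br x (P y)"
  using P_derivation_br by (simp add: derivation_of_def)

lemma br_skew: "x \<in> V \<Longrightarrow> y \<in> V \<Longrightarrow> br x y = - br y x"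
  using br_alternating[of "x + y"] br_alternating[of x] br_alternating[of y]
  by (simp add: eq_neg_iff_add_eq_0 add.commute)

lemma mul_left_comm: "x \<in> V \<Longrightarrow> y \<in> V \<Longrightarrow> z \<in> V \<Longrightarrow> mul x (mul y z) = mul y (mul x z)"
  using mul_assoc[of x y z] mul_assoc[of y x z] mul_comm[of x y] by simp

lemmas mul_ac = mul_assoc mul_comm mul_left_comm

lemma br_br: 
  assumes "x \<in> V" "y \<in> V" "z \<in> V"
  shows "br (br x y) z = br x (br y z) - br y (br x z)"
  using jacobi[OF assms] br_skew[of z x] br_skew[of z "br x y"] assms
  by (simp add: algebra_simps eq_neg_iff_add_eq_0)

lemma linear_endo_mul: "x \<in> V \<Longrightarrow> linear_endo scale V (mul x)"
  and linear_endo_br: "x \<in> V \<Longrightarrow> linear_endo scale V (br x)"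
  using mul_bilinear br_bilinear by (auto simp: bilinear_op_def)

text \<open>
  The first two conditions are the derivation property of \<open>P\<close>. In the cyclic one, expanding the
  brackets by the relative Leibniz rule leaves three terms \<open>y z P(x)\<close>, which add up to \<open>P(x y z)\<close>;
  the terms with brackets cancel in pairs.
\<close>

theorem dually_represented_uminus: "dually_represented scale V mul br P (\<lambda>x. - P x)"
proof
  show "linear_endo scale V (\<lambda>x. - P x)" by (auto simp: linear_endo_def)
  fix x y z assume V: "x \<in> V" "y \<in> V" "z \<in> V"
  show "mul x (- P y) - mul (P x) y - - P (mul x y) = 0" using V by (simp add: P_mul)
  show "br x (- P y) - br (P x) y - - P (br x y) = 0" using V by (simp add: P_br)
  show "br x (mul y z) + br y (mul z x) + br z (mul x y) + - P (mul (mul x y) z) = 0"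
    using V br_skew[of y x] br_skew[of z x] br_skew[of z y]
    by (simp add: relative_leibniz P_mul mul_ac)
qed

end

definition coboundary_mul ::
    "('v \<Rightarrow> 'v \<Rightarrow> 'v) \<Rightarrow> ('v \<times> 'v \<Rightarrow>\<^sub>0 'k::field) \<Rightarrow> 'v \<Rightarrow> ('v \<times> 'v \<Rightarrow>\<^sub>0 'k)" where
  "coboundary_mul mul r u = tmap2 id (mul u) r - tmap2 (mul u) id r"

definition coboundary_br ::
    "('v \<Rightarrow> 'v \<Rightarrow> 'v) \<Rightarrow> ('v \<times> 'v \<Rightarrow>\<^sub>0 'k::field) \<Rightarrow> 'v \<Rightarrow> ('v \<times> 'v \<Rightarrow>\<^sub>0 'k)" where
  "coboundary_br br r u = tmap2 (br u) id r + tmap2 id (br u) r"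

context relative_poisson_algebra
begin

context
  fixes r :: "'v \<times> 'v \<Rightarrow>\<^sub>0 'k"
  assumes r: "r \<in> tensor2_space V"
begin

lemma coboundary_closed:
  assumes u: "u \<in> V"
  shows "coboundary_mul mul r u \<in> tensor2_space V" "coboundary_br br r u \<in> tensor2_space V"
  unfolding coboundary_mul_def coboundary_br_def using r u by (auto intro!: tensor2_space_closed tmap2_closed)

lemma coboundary_mul_linear: "linear_to_tensor2 scale V (coboundary_mul mul r)"
  unfolding linear_to_tensor2_def
proof (intro conjI ballI allI)
  fix x y assume V: "x \<in> V" "y \<in> V"
  show "coboundary_mul mul r x \<in> tensor2_space V" using V by (simp add: coboundary_closed)
  show "coboundary_mul mul r (x + y) \<approx>\<^sub>2 coboundary_mul mul r x + coboundary_mul mul r y"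
  proof (rule tensor2_eqI)
    fix f g assume fg: "linear_functional scale V f" "linear_functional scale V g"
    show "pairing (\<lambda>(x, y). f x * g y) (coboundary_mul mul r (x + y)) =
        pairing (\<lambda>(x, y). f x * g y) (coboundary_mul mul r x + coboundary_mul mul r y)"
      by (simp add: coboundary_mul_def, simp only: pairing_collect, rule pairing_cong2[OF r])
         (use V in \<open>simp add: fg[THEN linear_functionalD(1)] algebra_simps\<close>)
  qed (use V in \<open>auto intro!: tensor2_space_closed coboundary_closed\<close>)
next
  fix c x assume V: "x \<in> V"
  show "coboundary_mul mul r (scale c x) \<approx>\<^sub>2 fscale c (coboundary_mul mul r x)"
  proof (rule tensor2_eqI)
    fix f g assume fg: "linear_functional scale V f" "linear_functional scale V g"
    show "pairing (\<lambda>(x, y). f x * g y) (coboundary_mul mul r (scale c x)) =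
        pairing (\<lambda>(x, y). f x * g y) (fscale c (coboundary_mul mul r x))"
      by (simp add: coboundary_mul_def, simp only: pairing_collect, rule pairing_cong2[OF r])
         (use V in \<open>simp add: fg[THEN linear_functionalD(3)] algebra_simps\<close>)
  qed (use V in \<open>auto intro!: tensor2_space_closed coboundary_closed\<close>)
qed

lemma coboundary_br_linear: "linear_to_tensor2 scale V (coboundary_br br r)"
  unfolding linear_to_tensor2_def
proof (intro conjI ballI allI)
  fix x y assume V: "x \<in> V" "y \<in> V"
  show "coboundary_br br r x \<in> tensor2_space V" using V by (simp add: coboundary_closed)
  show "coboundary_br br r (x + y) \<approx>\<^sub>2 coboundary_br br r x + coboundary_br br r y"
  proof (rule tensor2_eqI)
    fix f g assume fg: "linear_functional scale V f" "linear_functional scale V g"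
    show "pairing (\<lambda>(x, y). f x * g y) (coboundary_br br r (x + y)) =
        pairing (\<lambda>(x, y). f x * g y) (coboundary_br br r x + coboundary_br br r y)"
      by (simp add: coboundary_br_def, simp only: pairing_collect, rule pairing_cong2[OF r])
         (use V in \<open>simp add: fg[THEN linear_functionalD(1)] algebra_simps\<close>)
  qed (use V in \<open>auto intro!: tensor2_space_closed coboundary_closed\<close>)
next
  fix c x assume V: "x \<in> V"
  show "coboundary_br br r (scale c x) \<approx>\<^sub>2 fscale c (coboundary_br br r x)"
  proof (rule tensor2_eqI)
    fix f g assume fg: "linear_functional scale V f" "linear_functional scale V g"
    show "pairing (\<lambda>(x, y). f x * g y) (coboundary_br br r (scale c x)) =
        pairing (\<lambda>(x, y). f x * g y) (fscale c (coboundary_br br r x))"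
      by (simp add: coboundary_br_def, simp only: pairing_collect, rule pairing_cong2[OF r])
         (use V in \<open>simp add: fg[THEN linear_functionalD(3)] algebra_simps\<close>)
  qed (use V in \<open>auto intro!: tensor2_space_closed coboundary_closed\<close>)
qed

text \<open>
  In this and the next three theorems, applying the coproducts to \<open>r\<close> yields terms \<open>(F \<otimes> G) r\<close> with
  \<open>F\<close> and \<open>G\<close> compositions of multiplication operators. Terms with a multiplication operator on
  both legs cancel; in the others one leg carries an identity between operators. Here it is
  associativity together with commutativity.
\<close>

theorem coboundary_mul_mul:
  assumes V: "x \<in> V" "y \<in> V"
  shows "coboundary_mul mul r (mul x y) \<approx>\<^sub>2
    tmap2 (mul x) id (coboundary_mul mul r y) + tmap2 id (mul y) (coboundary_mul mul r x)"
proof (rule tensor2_eqI)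
  fix f g assume fg: "linear_functional scale V f" "linear_functional scale V g"
  show "pairing (\<lambda>(x, y). f x * g y) (coboundary_mul mul r (mul x y)) =
    pairing (\<lambda>(x, y). f x * g y)
      (tmap2 (mul x) id (coboundary_mul mul r y) + tmap2 id (mul y) (coboundary_mul mul r x))"
    by (simp add: coboundary_mul_def, simp only: pairing_collect, rule pairing_cong2[OF r])
       (use V in \<open>simp add: mul_assoc mul_left_comm[of x y]\<close>)
qed (use V in \<open>auto intro!: tensor2_space_closed tmap2_closed coboundary_closed\<close>)

theorem coboundary_br_br:
  assumes V: "x \<in> V" "y \<in> V"
  shows "coboundary_br br r (br x y) \<approx>\<^sub>2
    (tmap2 (br x) id (coboundary_br br r y) + tmap2 id (br x) (coboundary_br br r y))
    - (tmap2 (br y) id (coboundary_br br r x) + tmap2 id (br y) (coboundary_br br r x))"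
proof (rule tensor2_eqI)
  fix f g assume fg: "linear_functional scale V f" "linear_functional scale V g"
  show "pairing (\<lambda>(x, y). f x * g y) (coboundary_br br r (br x y)) =
    pairing (\<lambda>(x, y). f x * g y)
      ((tmap2 (br x) id (coboundary_br br r y) + tmap2 id (br x) (coboundary_br br r y))
       - (tmap2 (br y) id (coboundary_br br r x) + tmap2 id (br y) (coboundary_br br r x)))"
    by (simp add: coboundary_br_def, simp only: pairing_collect, rule pairing_cong2[OF r])
       (use V in \<open>simp add: br_br fg[THEN linear_functionalD(2)] algebra_simps\<close>)
qed (use V in \<open>auto intro!: tensor2_space_closed tmap2_closed coboundary_closed\<close>)

theorem coboundary_mul_br:
  assumes V: "x \<in> V" "y \<in> V"
  defines "\<Delta> \<equiv> coboundary_mul mul r" and "\<delta> \<equiv> coboundary_br br r"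
  shows "\<Delta> (br x y) - tmap2 (mul y) id (\<delta> x) - tmap2 id (br x) (\<Delta> y)
        + tmap2 id (mul y) (\<delta> x) - tmap2 (br x) id (\<Delta> y) + \<Delta> (mul (P x) y) \<approx>\<^sub>2 0"
proof (rule tensor2_eqI)
  fix f g assume fg: "linear_functional scale V f" "linear_functional scale V g"
  \<comment> \<open>The relative Leibniz rule; it is the identity on both legs.\<close>
  have *: "mul (br x y) a = br x (mul y a) - mul y (br x a) - mul (mul (P x) y) a" if "a \<in> V" for a
    using V that relative_leibniz[of y a x] mul_ac(2)[of "mul y a" "P x"] by (simp add: mul_assoc)
  show "pairing (\<lambda>(x, y). f x * g y)
      (\<Delta> (br x y) - tmap2 (mul y) id (\<delta> x) - tmap2 id (br x) (\<Delta> y)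
        + tmap2 id (mul y) (\<delta> x) - tmap2 (br x) id (\<Delta> y) + \<Delta> (mul (P x) y)) =
    pairing (\<lambda>(x, y). f x * g y) 0"
    unfolding \<Delta>_def \<delta>_def pairing_zero
    by (simp add: coboundary_mul_def coboundary_br_def, simp only: pairing_collect,
        rule trans[OF pairing_cong2[OF r, where \<psi> = "\<lambda>_. 0"]])
       (use V in \<open>simp_all add: * fg[THEN linear_functionalD(1)] fg[THEN linear_functionalD(2)] algebra_simps pairing_def\<close>)
qed (unfold \<Delta>_def \<delta>_def, use V in \<open>auto intro!: tensor2_space_closed tmap2_closed coboundary_closed\<close>)

end

end

context dually_represented
begin

text \<open>
  The second leg carries the cyclic axiom of \<open>Q\<close>. The relative Leibniz rule makes the operators on the
  first leg add up to multiplication by \<open>x y\<close> after \<open>P\<close>, with a minus sign, and the invariance of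
  \<open>r\<close> cancels this against the term \<open>(L \<otimes> Q) r\<close> of \<open>(id \<otimes> Q) (\<Delta> (mul x y))\<close>, where \<open>L\<close> is
  multiplication by \<open>x y\<close>.
\<close>

theorem coboundary_br_mul:
  assumes r: "r \<in> tensor2_space V" and inv: "tmap2 P id r - tmap2 id Q r \<approx>\<^sub>2 0"
    and V: "x \<in> V" "y \<in> V"
  defines "\<Delta> \<equiv> coboundary_mul mul r" and "\<delta> \<equiv> coboundary_br br r"
  shows "\<delta> (mul x y) - tmap2 id (br y) (\<Delta> x) - tmap2 (mul x) id (\<delta> y)
    - tmap2 id (br x) (\<Delta> y) - tmap2 (mul y) id (\<delta> x) - tmap2 id Q (\<Delta> (mul x y)) \<approx>\<^sub>2 0"
proof (rule tensor2_eqI)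
  have Q: "\<And>x. x \<in> V \<Longrightarrow> Q x \<in> V" using Q_linear by (simp add: linear_endo_def)
  fix f g assume fg: "linear_functional scale V f" "linear_functional scale V g"
  have f': "linear_functional scale V (\<lambda>a. f (mul (mul x y) a))"
    by (rule linear_functional_compose[OF fg(1) linear_endo_mul]) (use V in simp)
  have inv': "pairing (\<lambda>(a, b). f (mul (mul x y) a) * g (Q b)) r =
      pairing (\<lambda>(a, b). f (mul (mul x y) (P a)) * g b) r"
    using pairing_tensor2_eq[OF inv f' fg(2)] by simp
  have *: "br (mul x y) a = mul x (br y a) + mul y (br x a) - mul (mul x y) (P a)" if "a \<in> V" for a
    using V that relative_leibniz[of x y a] br_skew[of "mul x y" a] br_skew[of a x] br_skew[of a y]
      mul_comm[of "br x a" y] by (simp add: algebra_simps)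
  have **: "br (mul x y) a = br y (mul x a) + br x (mul y a) + Q (mul (mul x y) a)" if "a \<in> V" for a
  proof -
    have "br y (mul x a) + br x (mul y a) + Q (mul (mul x y) a) + br a (mul x y) = 0"
      using V that Q_cyclic[of x y a] mul_comm[of a x] by (simp add: ac_simps)
    then have "br y (mul x a) + br x (mul y a) + Q (mul (mul x y) a) = - br a (mul x y)"
      by (simp only: eq_neg_iff_add_eq_0)
    then show ?thesis
      using V that br_skew[of "mul x y" a] by (simp only: mul_simps)
  qed
  have A: "pairing (\<lambda>(a, b). f (br (mul x y) a) * g b) r =
      pairing (\<lambda>(a, b). f (mul x (br y a)) * g b) r + pairing (\<lambda>(a, b). f (mul y (br x a)) * g b) r
      - pairing (\<lambda>(a, b). f (mul (mul x y) (P a)) * g b) r"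
    by (simp only: pairing_collect, rule pairing_cong2[OF r])
       (use V in \<open>simp add: * fg[THEN linear_functionalD(1)] fg[THEN linear_functionalD(2)] algebra_simps\<close>)
  have B: "pairing (\<lambda>(a, b). f a * g (br (mul x y) b)) r =
      pairing (\<lambda>(a, b). f a * g (br y (mul x b))) r + pairing (\<lambda>(a, b). f a * g (br x (mul y b))) r
      + pairing (\<lambda>(a, b). f a * g (Q (mul (mul x y) b))) r"
    by (simp only: pairing_collect, rule pairing_cong2[OF r])
       (use V Q in \<open>simp add: ** fg[THEN linear_functionalD(1)] algebra_simps\<close>)
  show "pairing (\<lambda>(x, y). f x * g y)
      (\<delta> (mul x y) - tmap2 id (br y) (\<Delta> x) - tmap2 (mul x) id (\<delta> y)
       - tmap2 id (br x) (\<Delta> y) - tmap2 (mul y) id (\<delta> x) - tmap2 id Q (\<Delta> (mul x y))) =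
    pairing (\<lambda>(x, y). f x * g y) 0"
    by (simp add: \<Delta>_def \<delta>_def coboundary_mul_def coboundary_br_def A B inv')
qed (unfold \<Delta>_def \<delta>_def, use V Q_linear coboundary_closed[OF r] in
      \<open>auto intro!: tensor2_space_closed tmap2_closed simp: linear_endo_def\<close>)

end

section \<open>Symplectic relative Poisson algebras\<close>

text \<open>
  \<open>p\<close> and \<open>q\<close> form a Darboux basis: \<open>darboux_expansion\<close> says that every vector is recovered from its
  values under \<open>\<omega>\<close>, so \<open>\<omega>\<close> is nondegenerate, and the tensor \<open>r\<close> below is its inverse. The two cyclic
  identities say that \<open>\<omega>\<close> is a cocycle for each of the products.
\<close>

locale symplectic_relative_poisson_algebra = relative_poisson_algebra scale V mul br P
  for scale :: "'k::{alg_closed_field, field_char_0} \<Rightarrow> 'v::ab_group_add \<Rightarrow> 'v"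
    and V mul br P +
  fixes \<omega> :: "'v \<Rightarrow> 'v \<Rightarrow> 'k" and I :: "'i set" and p q :: "'i \<Rightarrow> 'v"
  assumes form_linear: "X \<in> V \<Longrightarrow> linear_functional scale V (\<lambda>u. \<omega> u X)"
    and form_skew: "x \<in> V \<Longrightarrow> y \<in> V \<Longrightarrow> \<omega> x y = - \<omega> y x"
    and darboux_closed: "i \<in> I \<Longrightarrow> p i \<in> V" "i \<in> I \<Longrightarrow> q i \<in> V"
    and darboux_expansion: "x \<in> V \<Longrightarrow>
      x = (\<Sum>i\<in>I. scale (\<omega> (p i) x) (q i) - scale (\<omega> (q i) x) (p i))"
    and mul_cyclic: "x \<in> V \<Longrightarrow> y \<in> V \<Longrightarrow> z \<in> V \<Longrightarrow>
      \<omega> (mul x y) z + \<omega> (mul y z) x + \<omega> (mul z x) y = 0"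
    and br_cyclic: "x \<in> V \<Longrightarrow> y \<in> V \<Longrightarrow> z \<in> V \<Longrightarrow>
      \<omega> (br x y) z + \<omega> (br y z) x + \<omega> (br z x) y = 0"
    and P_skew: "x \<in> V \<Longrightarrow> y \<in> V \<Longrightarrow> \<omega> (P x) y = - \<omega> x (P y)"
begin

definition r :: "'v \<times> 'v \<Rightarrow>\<^sub>0 'k" where
  "r = (\<Sum>i\<in>I. pure2 (p i) (q i) - pure2 (q i) (p i))"

lemma r_closed: "r \<in> tensor2_space V"
  unfolding r_def by (auto intro!: tensor2_space_sum tensor2_space_closed darboux_closed)

lemma form_linear_right: "X \<in> V \<Longrightarrow> linear_functional scale V (\<omega> X)"
  using form_linear[of X] form_skew[of X] by (auto simp: linear_functional_def)

lemma form_simps [simp]: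
  assumes "x \<in> V" "y \<in> V" "z \<in> V"
  shows "\<omega> (x + y) z = \<omega> x z + \<omega> y z" "\<omega> (x - y) z = \<omega> x z - \<omega> y z" "\<omega> (- x) z = - \<omega> x z"
    "\<omega> z (x + y) = \<omega> z x + \<omega> z y" "\<omega> z (x - y) = \<omega> z x - \<omega> z y" "\<omega> z (- x) = - \<omega> z x"
  using linear_functionalD[OF form_linear[of z]] linear_functionalD[OF form_linear_right[of z]] assms
  by auto

lemma contract_left:
  assumes g: "linear_functional scale V g" and X: "X \<in> V"
  shows "pairing (\<lambda>(x, y). \<omega> x X * g y) r = g X"
proof -
  have "g X = g (\<Sum>i\<in>I. scale (\<omega> (p i) X) (q i) - scale (\<omega> (q i) X) (p i))"
    by (subst (1) darboux_expansion[OF X]) simp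
  also have "\<dots> = (\<Sum>i\<in>I. \<omega> (p i) X * g (q i) - \<omega> (q i) X * g (p i))"
    by (subst linear_functional_sum[OF g])
       (auto simp: darboux_closed linear_functionalD(2,3)[OF g] intro!: sum.cong)
  finally show ?thesis by (simp add: r_def)
qed

lemma contract_right:
  assumes g: "linear_functional scale V g" and X: "X \<in> V"
  shows "pairing (\<lambda>(x, y). g x * \<omega> y X) r = - g X"
proof -
  have "pairing (\<lambda>(x, y). g x * \<omega> y X) r = - pairing (\<lambda>(x, y). \<omega> x X * g y) r"
    by (simp add: r_def sum_negf[symmetric] mult.commute)
  then show ?thesis using contract_left[OF g X] by simp
qed

text \<open>
  Functionals are represented by vectors because contracting \<open>f\<close> with \<open>r\<close> gives a vector \<open>X\<close> for which
  \<open>contract_left\<close> reads \<open>f u = \<omega> u X\<close>.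
\<close>

lemma riesz:
  assumes f: "linear_functional scale V f"
  obtains X where "X \<in> V" "\<And>u. u \<in> V \<Longrightarrow> f u = \<omega> u X"
proof
  let ?X = "\<Sum>i\<in>I. scale (f (p i)) (q i) - scale (f (q i)) (p i)"
  show "?X \<in> V"
    by (auto intro!: subspace_sum[OF subspace_carrier] simp: darboux_closed)
  fix u assume u: "u \<in> V"
  have "f u = (\<Sum>i\<in>I. \<omega> (p i) u * f (q i) - \<omega> (q i) u * f (p i))"
    using contract_left[OF f u] by (simp add: r_def)
  also have "\<dots> = (\<Sum>i\<in>I. \<omega> u (scale (f (p i)) (q i) - scale (f (q i)) (p i)))"
    using u form_skew[of _ u] linear_functionalD(2,3)[OF form_linear_right[OF u]]
    by (auto intro!: sum.cong simp: darboux_closed)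
  also have "\<dots> = \<omega> u ?X"
    by (rule linear_functional_sum[OF form_linear_right[OF u], symmetric])
       (simp add: darboux_closed)
  finally show "f u = \<omega> u ?X" .
qed

lemma tensor2_form_eqI:
  assumes st: "s \<in> tensor2_space V" "t \<in> tensor2_space V"
    and eq: "\<And>X Y. X \<in> V \<Longrightarrow> Y \<in> V \<Longrightarrow>
      pairing (\<lambda>(x, y). \<omega> x X * \<omega> y Y) s = pairing (\<lambda>(x, y). \<omega> x X * \<omega> y Y) t"
  shows "s \<approx>\<^sub>2 t"
proof (rule tensor2_eqI[OF st])
  fix f g assume "linear_functional scale V f" "linear_functional scale V g"
  then obtain X Y where X: "X \<in> V" "\<And>u. u \<in> V \<Longrightarrow> f u = \<omega> u X"
    and Y: "Y \<in> V" "\<And>u. u \<in> V \<Longrightarrow> g u = \<omega> u Y"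
    by (metis riesz)
  have "pairing (\<lambda>(x, y). f x * g y) t = pairing (\<lambda>(x, y). \<omega> x X * \<omega> y Y) t"
    if "t \<in> tensor2_space V" for t
    by (rule pairing_cong2[OF that]) (simp add: X Y)
  then show "pairing (\<lambda>(x, y). f x * g y) s = pairing (\<lambda>(x, y). f x * g y) t"
    using st eq[OF X(1) Y(1)] by simp
qed

lemma tensor3_form_eqI:
  assumes st: "s \<in> tensor3_space V" "t \<in> tensor3_space V"
    and eq: "\<And>X Y Z. X \<in> V \<Longrightarrow> Y \<in> V \<Longrightarrow> Z \<in> V \<Longrightarrow>
      pairing (\<lambda>(x, y, z). \<omega> x X * \<omega> y Y * \<omega> z Z) s =
      pairing (\<lambda>(x, y, z). \<omega> x X * \<omega> y Y * \<omega> z Z) t"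
  shows "s \<approx>\<^sub>3 t"
proof (rule tensor3_eqI[OF st])
  fix f g h
  assume "linear_functional scale V f" "linear_functional scale V g" "linear_functional scale V h"
  then obtain X Y Z where X: "X \<in> V" "\<And>u. u \<in> V \<Longrightarrow> f u = \<omega> u X"
    and Y: "Y \<in> V" "\<And>u. u \<in> V \<Longrightarrow> g u = \<omega> u Y"
    and Z: "Z \<in> V" "\<And>u. u \<in> V \<Longrightarrow> h u = \<omega> u Z"
    by (metis riesz)
  have "pairing (\<lambda>(x, y, z). f x * g y * h z) t = pairing (\<lambda>(x, y, z). \<omega> x X * \<omega> y Y * \<omega> z Z) t"
    if "t \<in> tensor3_space V" for t
    by (rule pairing_cong[of t "V \<times> V \<times> V"])
       (use that in \<open>auto simp: tensor3_space_def X Y Z\<close>)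
  then show "pairing (\<lambda>(x, y, z). f x * g y * h z) s = pairing (\<lambda>(x, y, z). f x * g y * h z) t"
    using st eq[OF X(1) Y(1) Z(1)] by simp
qed

lemma tensor3_zero_closed: "0 \<in> tensor3_space V"
  by (simp add: tensor3_space_def)

theorem antisymmetric_r: "antisymmetric_tensor scale V r"
  unfolding antisymmetric_tensor_def
proof
  show "r + twist r \<approx>\<^sub>2 0"
  proof (rule tensor2_form_eqI)
    fix X Y assume V: "X \<in> V" "Y \<in> V"
    show "pairing (\<lambda>(x, y). \<omega> x X * \<omega> y Y) (r + twist r) = pairing (\<lambda>(x, y). \<omega> x X * \<omega> y Y) 0"
      using contract_left[OF form_linear[OF V(2)] V(1)] contract_right[OF form_linear[OF V(2)] V(1)]
      by (simp add: mult.commute)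
  qed (auto intro!: tensor2_space_closed twist_closed r_closed)
qed (rule r_closed)

text \<open>
  In each product of \<open>r\<close> with itself two of the three functionals each meet a leg of one copy directly.
  Contracting with them replaces the arguments of \<open>m\<close> by the vectors representing these
  functionals, up to sign.
\<close>

lemma pairing_r_products:
  assumes m: "bilinear_op scale V m" and V: "X \<in> V" "Y \<in> V" "Z \<in> V"
  shows "pairing (\<lambda>(x, y, z). \<omega> x X * \<omega> y Y * \<omega> z Z) (r12_r13 m r) = \<omega> (m Y Z) X"
    and "pairing (\<lambda>(x, y, z). \<omega> x X * \<omega> y Y * \<omega> z Z) (r12_r23 m r) = - \<omega> (m X Z) Y"
    and "pairing (\<lambda>(x, y, z). \<omega> x X * \<omega> y Y * \<omega> z Z) (r13_r23 m r) = \<omega> (m X Y) Z"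
proof -
  have L: "linear_functional scale V (\<lambda>b. \<omega> (m a b) W)"
    and R: "linear_functional scale V (\<lambda>b. \<omega> (m b a) W)" if "a \<in> V" "W \<in> V" for a W
    using m that
    by (auto intro!: linear_functional_compose[OF form_linear] simp: bilinear_op_def)
  have "pairing (\<lambda>(a, b). pairing (\<lambda>(a', b'). \<omega> (m a a') X * \<omega> b Y * \<omega> b' Z) r) r =
      pairing (\<lambda>(a, b). - (\<omega> (m a Z) X * \<omega> b Y)) r"
  proof (rule pairing_cong2[OF r_closed], clarsimp)
    fix a b assume "a \<in> V" "b \<in> V"
    then have "\<omega> b Y * pairing (\<lambda>(a', b'). \<omega> (m a a') X * \<omega> b' Z) r = - (\<omega> (m a Z) X * \<omega> b Y)"
      using contract_right[OF L, of a X Z] V by simp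
    then show "pairing (\<lambda>(a', b'). \<omega> (m a a') X * \<omega> b Y * \<omega> b' Z) r = - (\<omega> (m a Z) X * \<omega> b Y)"
      by (simp add: pairing_fun_scale[symmetric] case_prod_unfold ac_simps)
  qed
  then show "pairing (\<lambda>(x, y, z). \<omega> x X * \<omega> y Y * \<omega> z Z) (r12_r13 m r) = \<omega> (m Y Z) X"
    using contract_right[OF R, of Z X Y] V pairing_fun_minus[of "\<lambda>(a, b). \<omega> (m a Z) X * \<omega> b Y" r]
    by (simp add: pairing_r12_r13 case_prod_unfold)
  have "pairing (\<lambda>(a, b). pairing (\<lambda>(a', b'). \<omega> a X * \<omega> (m b a') Y * \<omega> b' Z) r) r =
      pairing (\<lambda>(a, b). - (\<omega> a X * \<omega> (m b Z) Y)) r"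
  proof (rule pairing_cong2[OF r_closed], clarsimp)
    fix a b assume "a \<in> V" "b \<in> V"
    then have "\<omega> a X * pairing (\<lambda>(a', b'). \<omega> (m b a') Y * \<omega> b' Z) r = - (\<omega> a X * \<omega> (m b Z) Y)"
      using contract_right[OF L, of b Y Z] V by simp
    then show "pairing (\<lambda>(a', b'). \<omega> a X * \<omega> (m b a') Y * \<omega> b' Z) r = - (\<omega> a X * \<omega> (m b Z) Y)"
      by (simp add: pairing_fun_scale[symmetric] case_prod_unfold ac_simps)
  qed
  then show "pairing (\<lambda>(x, y, z). \<omega> x X * \<omega> y Y * \<omega> z Z) (r12_r23 m r) = - \<omega> (m X Z) Y"
    using contract_left[OF R, of Z Y X] V pairing_fun_minus[of "\<lambda>(a, b). \<omega> a X * \<omega> (m b Z) Y" r]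
    by (simp add: pairing_r12_r23 case_prod_unfold)
  have "pairing (\<lambda>(a, b). pairing (\<lambda>(a', b'). \<omega> a X * \<omega> a' Y * \<omega> (m b b') Z) r) r =
      pairing (\<lambda>(a, b). \<omega> a X * \<omega> (m b Y) Z) r"
  proof (rule pairing_cong2[OF r_closed], clarsimp)
    fix a b assume "a \<in> V" "b \<in> V"
    then have "\<omega> a X * pairing (\<lambda>(a', b'). \<omega> a' Y * \<omega> (m b b') Z) r = \<omega> a X * \<omega> (m b Y) Z"
      using contract_left[OF L, of b Z Y] V by simp
    then show "pairing (\<lambda>(a', b'). \<omega> a X * \<omega> a' Y * \<omega> (m b b') Z) r = \<omega> a X * \<omega> (m b Y) Z"
      by (simp add: pairing_fun_scale[symmetric] case_prod_unfold ac_simps)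
  qed
  then show "pairing (\<lambda>(x, y, z). \<omega> x X * \<omega> y Y * \<omega> z Z) (r13_r23 m r) = \<omega> (m X Y) Z"
    using contract_left[OF R, of Y Z X] V
    by (simp add: pairing_r13_r23 case_prod_unfold)
qed

text \<open>
  Moving \<open>P\<close> from one leg of \<open>r\<close> to the other is the skewness of \<open>P\<close> with respect to \<open>\<omega>\<close>.
\<close>

lemma r_invariant: "tmap2 P id r - tmap2 id (\<lambda>x. - P x) r \<approx>\<^sub>2 0"
  and r_invariant': "tmap2 (\<lambda>x. - P x) id r - tmap2 id P r \<approx>\<^sub>2 0"
proof -
  have eq: "pairing (\<lambda>(x, y). \<omega> (P x) X * \<omega> y Y) r + pairing (\<lambda>(x, y). \<omega> x X * \<omega> (P y) Y) r = 0"
    if V: "X \<in> V" "Y \<in> V" for X Y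
    using contract_left[OF linear_functional_compose[OF form_linear[OF V(2)] P_linear] V(1)]
      contract_right[OF linear_functional_compose[OF form_linear[OF V(1)] P_linear] V(2)]
      P_skew[OF V] form_skew[of X "P Y"] V by simp
  have neg: "pairing (\<lambda>(x, y). \<omega> (- P x) X * \<omega> y Y) r = - pairing (\<lambda>(x, y). \<omega> (P x) X * \<omega> y Y) r"
    "pairing (\<lambda>(x, y). \<omega> x X * \<omega> (- P y) Y) r = - pairing (\<lambda>(x, y). \<omega> x X * \<omega> (P y) Y) r"
    if V: "X \<in> V" "Y \<in> V" for X Y
    by (simp only: pairing_collect, rule pairing_cong2[OF r_closed], use V in simp)+
  show "tmap2 P id r - tmap2 id (\<lambda>x. - P x) r \<approx>\<^sub>2 0"
    by (rule tensor2_form_eqI)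
       (use eq neg in \<open>auto intro!: tensor2_space_closed tmap2_closed r_closed\<close>)
  show "tmap2 (\<lambda>x. - P x) id r - tmap2 id P r \<approx>\<^sub>2 0"
  proof (rule tensor2_form_eqI)
    fix X Y assume "X \<in> V" "Y \<in> V"
    then show "pairing (\<lambda>(x, y). \<omega> x X * \<omega> y Y) (tmap2 (\<lambda>x. - P x) id r - tmap2 id P r) =
        pairing (\<lambda>(x, y). \<omega> x X * \<omega> y Y) 0"
      using eq[of X Y] neg[of X Y] by (simp add: add_eq_0_iff)
  qed (auto intro!: tensor2_space_closed tmap2_closed r_closed)
qed

theorem rpybe_solution_r: "rpybe_solution scale V mul br P (\<lambda>x. - P x) r"
proof
  show "linear_endo scale V (\<lambda>x. - P x)" by (auto simp: linear_endo_def)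
  show "r \<in> tensor2_space V" by (rule r_closed)
  show "r12_r13 mul r - r12_r23 mul r + r13_r23 mul r \<approx>\<^sub>3 0"
  proof (rule tensor3_form_eqI)
    fix X Y Z assume V: "X \<in> V" "Y \<in> V" "Z \<in> V"
    have "\<omega> (mul Y Z) X + \<omega> (mul X Z) Y + \<omega> (mul X Y) Z = 0"
      using mul_cyclic[OF V] mul_comm[of X Z] V by (simp add: ac_simps)
    then show "pairing (\<lambda>(x, y, z). \<omega> x X * \<omega> y Y * \<omega> z Z) (r12_r13 mul r - r12_r23 mul r + r13_r23 mul r)
        = pairing (\<lambda>(x, y, z). \<omega> x X * \<omega> y Y * \<omega> z Z) 0"
      by (simp add: pairing_r_products[OF mul_bilinear V])
  qed (auto intro!: tensor3_space_closed tensor3_zero_closed r_products_closed r_closed)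
  show "r12_r13 br r + r12_r23 br r + r13_r23 br r \<approx>\<^sub>3 0"
  proof (rule tensor3_form_eqI)
    fix X Y Z assume V: "X \<in> V" "Y \<in> V" "Z \<in> V"
    have "\<omega> (br Y Z) X - \<omega> (br X Z) Y + \<omega> (br X Y) Z = 0"
      using br_cyclic[OF V] br_skew[of X Z] V by (simp add: ac_simps)
    then show "pairing (\<lambda>(x, y, z). \<omega> x X * \<omega> y Y * \<omega> z Z) (r12_r13 br r + r12_r23 br r + r13_r23 br r)
        = pairing (\<lambda>(x, y, z). \<omega> x X * \<omega> y Y * \<omega> z Z) 0"
      by (simp add: pairing_r_products[OF br_bilinear V])
  qed (auto intro!: tensor3_space_closed tensor3_zero_closed r_products_closed r_closed)
qed (rule r_invariant r_invariant')+

abbreviation \<Delta> where "\<Delta> \<equiv> coboundary_mul mul r"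
abbreviation \<delta> where "\<delta> \<equiv> coboundary_br br r"

text \<open>
  Contracting \<open>r\<close> gives \<open>\<omega> (mul u X) Y + \<omega> (mul u Y) X\<close>, which is \<open>\<omega> u (mul X Y)\<close> by the cyclic
  identity.
\<close>

lemma pairing_\<Delta>:
  assumes V: "u \<in> V" "X \<in> V" "Y \<in> V"
  shows "pairing (\<lambda>(x, y). \<omega> x X * \<omega> y Y) (\<Delta> u) = \<omega> u (mul X Y)"
  using contract_left[OF linear_functional_compose[OF form_linear[OF V(3)] linear_endo_mul[OF V(1)]] V(2)]
    contract_right[OF linear_functional_compose[OF form_linear[OF V(2)] linear_endo_mul[OF V(1)]] V(3)]
    mul_cyclic[OF V(2,3,1)] form_skew[of u "mul X Y"] mul_comm[of Y u] V
  by (simp add: coboundary_mul_def add_eq_0_iff algebra_simps)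

lemma pairing_\<delta>:
  assumes V: "u \<in> V" "X \<in> V" "Y \<in> V"
  shows "pairing (\<lambda>(x, y). \<omega> x X * \<omega> y Y) (\<delta> u) = \<omega> u (br X Y)"
  using contract_left[OF linear_functional_compose[OF form_linear[OF V(3)] linear_endo_br[OF V(1)]] V(2)]
    contract_right[OF linear_functional_compose[OF form_linear[OF V(2)] linear_endo_br[OF V(1)]] V(3)]
    br_cyclic[OF V(2,3,1)] form_skew[of u "br X Y"] br_skew[of Y u] V
  by (simp add: coboundary_br_def add_eq_0_iff algebra_simps)

text \<open>
  Iterated coproducts are transposes of iterated products.
\<close>

lemma pairing_id_tensor_form:
  assumes D: "\<And>u X Y. u \<in> V \<Longrightarrow> X \<in> V \<Longrightarrow> Y \<in> V \<Longrightarrow>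
      pairing (\<lambda>(x, y). \<omega> x X * \<omega> y Y) (D u) = \<omega> u (m X Y)"
    and t: "t \<in> tensor2_space V" and V: "X \<in> V" "Y \<in> V" "Z \<in> V"
  shows "pairing (\<lambda>(x, y, z). \<omega> x X * \<omega> y Y * \<omega> z Z) (id_tensor D t) =
      pairing (\<lambda>(x, y). \<omega> x X * \<omega> y (m Y Z)) t"
  unfolding pairing_id_tensor
proof (rule pairing_cong2[OF t], clarsimp)
  fix x y assume "x \<in> V" "y \<in> V"
  then have "\<omega> x X * pairing (\<lambda>(a, b). \<omega> a Y * \<omega> b Z) (D y) = \<omega> x X * \<omega> y (m Y Z)"
    using D V by simp
  then show "pairing (\<lambda>(a, b). \<omega> x X * \<omega> a Y * \<omega> b Z) (D y) = \<omega> x X * \<omega> y (m Y Z)"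
    by (simp add: pairing_fun_scale[symmetric] case_prod_unfold ac_simps)
qed

lemma pairing_tensor_id_form:
  assumes D: "\<And>u X Y. u \<in> V \<Longrightarrow> X \<in> V \<Longrightarrow> Y \<in> V \<Longrightarrow>
      pairing (\<lambda>(x, y). \<omega> x X * \<omega> y Y) (D u) = \<omega> u (m X Y)"
    and t: "t \<in> tensor2_space V" and V: "X \<in> V" "Y \<in> V" "Z \<in> V"
  shows "pairing (\<lambda>(x, y, z). \<omega> x X * \<omega> y Y * \<omega> z Z) (tensor_id D t) =
      pairing (\<lambda>(x, y). \<omega> x (m X Y) * \<omega> y Z) t"
  unfolding pairing_tensor_id
proof (rule pairing_cong2[OF t], clarsimp)
  fix x y assume "x \<in> V" "y \<in> V"
  then have "\<omega> y Z * pairing (\<lambda>(a, b). \<omega> a X * \<omega> b Y) (D x) = \<omega> x (m X Y) * \<omega> y Z"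
    using D V by simp
  then show "pairing (\<lambda>(a, b). \<omega> a X * \<omega> b Y * \<omega> y Z) (D x) = \<omega> x (m X Y) * \<omega> y Z"
    by (simp add: pairing_fun_scale[symmetric] case_prod_unfold ac_simps)
qed

lemma pairing_cyc_form:
  "pairing (\<lambda>(x, y, z). \<omega> x X * \<omega> y Y * \<omega> z Z) (cyc t) =
    pairing (\<lambda>(x, y, z). \<omega> x Z * \<omega> y X * \<omega> z Y) t"
  by (simp add: ac_simps)

lemma pairing_twist_id_form:
  "pairing (\<lambda>(x, y, z). \<omega> x X * \<omega> y Y * \<omega> z Z) (twist_id t) =
    pairing (\<lambda>(x, y, z). \<omega> x Y * \<omega> y X * \<omega> z Z) t"
  by (simp add: ac_simps)

lemma pairing_P_form:
  assumes t: "t \<in> tensor2_space V" and V: "X \<in> V" "Y \<in> V"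
  shows "pairing (\<lambda>(x, y). \<omega> (P x) X * \<omega> y Y) t = - pairing (\<lambda>(x, y). \<omega> x (P X) * \<omega> y Y) t"
    "pairing (\<lambda>(x, y). \<omega> x X * \<omega> (P y) Y) t = - pairing (\<lambda>(x, y). \<omega> x X * \<omega> y (P Y)) t"
    "pairing (\<lambda>(x, y). \<omega> (- P x) X * \<omega> y Y) t = pairing (\<lambda>(x, y). \<omega> x (P X) * \<omega> y Y) t"
    "pairing (\<lambda>(x, y). \<omega> x X * \<omega> (- P y) Y) t = pairing (\<lambda>(x, y). \<omega> x X * \<omega> y (P Y)) t"
  by ((simp only: pairing_collect)?, rule pairing_cong2[OF t], use V in \<open>simp add: P_skew\<close>)+

lemma pairing_tmap3_P_form:
  assumes t: "t \<in> tensor3_space V" and V: "X \<in> V"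
  shows "pairing (\<lambda>(x, y, z). \<omega> x X * \<omega> y Y * \<omega> z Z) (tmap3 (\<lambda>x. - P x) id id t) =
    pairing (\<lambda>(x, y, z). \<omega> x (P X) * \<omega> y Y * \<omega> z Z) t"
  unfolding pairing_tmap3
  by (rule pairing_cong[of t "V \<times> V \<times> V"]) (use assms in \<open>auto simp: tensor3_space_def P_skew\<close>)

lemmas coproduct_closed = coboundary_closed[OF r_closed]

lemmas space_closed = tensor2_space_closed tensor3_space_closed tensor3_zero_closed tmap2_closed
  twist_closed tmap3_closed twist_id_closed cyc_closed id_tensor_closed tensor_id_closed
  coproduct_closed

lemmas pairing_iterated =
  pairing_id_tensor_form[OF pairing_\<Delta>] pairing_id_tensor_form[OF pairing_\<delta>]
  pairing_tensor_id_form[OF pairing_\<Delta>] pairing_tensor_id_form[OF pairing_\<delta>]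

text \<open>
  Tested on functionals \<open>\<omega> _ X\<close>, each axiom at \<open>u\<close> states that \<open>\<omega> u\<close> takes equal values on the two
  sides of the corresponding axiom of relative Poisson algebras. The co-Leibniz rule becomes the
  relative Leibniz rule because \<open>P\<close> is the adjoint of \<open>- P\<close>.
\<close>

theorem coalgebra: "relative_poisson_coalgebra scale V \<Delta> \<delta> (\<lambda>x. - P x)"
proof
  show "linear_to_tensor2 scale V \<Delta>" "linear_to_tensor2 scale V \<delta>"
    by (rule coboundary_mul_linear[OF r_closed] coboundary_br_linear[OF r_closed])+
  show "linear_endo scale V (\<lambda>x. - P x)" by (auto simp: linear_endo_def)
  fix u assume u: "u \<in> V"
  note cl = coproduct_closed[OF u]
  show "twist (\<Delta> u) \<approx>\<^sub>2 \<Delta> u"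
  proof (rule tensor2_form_eqI)
    fix X Y assume V: "X \<in> V" "Y \<in> V"
    show "pairing (\<lambda>(x, y). \<omega> x X * \<omega> y Y) (twist (\<Delta> u)) = pairing (\<lambda>(x, y). \<omega> x X * \<omega> y Y) (\<Delta> u)"
      using V u pairing_\<Delta>[of u Y X] by (simp add: pairing_\<Delta> mul_comm mult.commute)
  qed (use u in \<open>auto intro!: space_closed\<close>)
  show "twist (\<delta> u) \<approx>\<^sub>2 - \<delta> u"
  proof (rule tensor2_form_eqI)
    fix X Y assume V: "X \<in> V" "Y \<in> V"
    show "pairing (\<lambda>(x, y). \<omega> x X * \<omega> y Y) (twist (\<delta> u)) = pairing (\<lambda>(x, y). \<omega> x X * \<omega> y Y) (- \<delta> u)"
      using V u pairing_\<delta>[of u Y X] br_skew[of X Y] by (simp add: pairing_\<delta> mult.commute)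
  qed (use u in \<open>auto intro!: space_closed\<close>)
  show "id_tensor \<Delta> (\<Delta> u) \<approx>\<^sub>3 tensor_id \<Delta> (\<Delta> u)"
    by (rule tensor3_form_eqI)
       (use u cl in \<open>auto intro!: space_closed simp del: pairing_id_tensor pairing_tensor_id
          simp: pairing_iterated pairing_\<Delta> mul_assoc\<close>)
  show "id_tensor \<delta> (\<delta> u) + cyc (id_tensor \<delta> (\<delta> u)) + cyc (cyc (id_tensor \<delta> (\<delta> u))) \<approx>\<^sub>3 0"
  proof (rule tensor3_form_eqI)
    fix X Y Z assume V: "X \<in> V" "Y \<in> V" "Z \<in> V"
    have "br X (br Y Z) + br Z (br X Y) + br Y (br Z X) = 0"
      using jacobi[OF V] by (simp add: ac_simps)
    then have "\<omega> u (br X (br Y Z) + br Z (br X Y) + br Y (br Z X)) = 0"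
      using linear_functional_zero[OF form_linear_right[OF u]] by simp
    then show "pairing (\<lambda>(x, y, z). \<omega> x X * \<omega> y Y * \<omega> z Z)
        (id_tensor \<delta> (\<delta> u) + cyc (id_tensor \<delta> (\<delta> u)) + cyc (cyc (id_tensor \<delta> (\<delta> u)))) =
        pairing (\<lambda>(x, y, z). \<omega> x X * \<omega> y Y * \<omega> z Z) 0"
      using V u cl
      by (simp del: pairing_id_tensor pairing_cyc
          add: pairing_cyc_form pairing_iterated pairing_\<delta>)
  qed (use u in \<open>auto intro!: space_closed\<close>)
  show "\<Delta> (- P u) \<approx>\<^sub>2 tmap2 (\<lambda>x. - P x) id (\<Delta> u) + tmap2 id (\<lambda>x. - P x) (\<Delta> u)"
    by (rule tensor2_form_eqI)
       (use u cl in \<open>auto intro!: space_closed simp: pairing_P_form pairing_\<Delta> P_skew P_mul\<close>)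
  show "\<delta> (- P u) \<approx>\<^sub>2 tmap2 (\<lambda>x. - P x) id (\<delta> u) + tmap2 id (\<lambda>x. - P x) (\<delta> u)"
    by (rule tensor2_form_eqI)
       (use u cl in \<open>auto intro!: space_closed simp: pairing_P_form pairing_\<delta> P_skew P_br\<close>)
  show "id_tensor \<Delta> (\<delta> u) - tensor_id \<delta> (\<Delta> u) - twist_id (id_tensor \<delta> (\<Delta> u))
        - tmap3 (\<lambda>x. - P x) id id (tensor_id \<Delta> (\<Delta> u)) \<approx>\<^sub>3 0"
  proof (rule tensor3_form_eqI)
    fix X Y Z assume V: "X \<in> V" "Y \<in> V" "Z \<in> V"
    have L: "br X (mul Y Z) = mul (br X Y) Z + mul Y (br X Z) + mul (mul (P X) Y) Z"
      using relative_leibniz[of Y Z X] V by (simp add: mul_ac)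
    show "pairing (\<lambda>(x, y, z). \<omega> x X * \<omega> y Y * \<omega> z Z)
        (id_tensor \<Delta> (\<delta> u) - tensor_id \<delta> (\<Delta> u) - twist_id (id_tensor \<delta> (\<Delta> u))
        - tmap3 (\<lambda>x. - P x) id id (tensor_id \<Delta> (\<Delta> u))) =
        pairing (\<lambda>(x, y, z). \<omega> x X * \<omega> y Y * \<omega> z Z) 0"
      using V u cl
      by (simp del: pairing_id_tensor pairing_tensor_id pairing_twist_id pairing_tmap3
          add: pairing_twist_id_form pairing_tmap3_P_form pairing_iterated pairing_\<Delta> pairing_\<delta> L
          tensor_id_closed coproduct_closed)
  qed (use u in \<open>auto intro!: space_closed\<close>)
qed

theorem bialgebra: "relative_poisson_bialgebra scale V mul br \<Delta> \<delta> P (\<lambda>x. - P x)"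
proof -
  interpret dually_represented scale V mul br P "\<lambda>x. - P x"
    by (rule dually_represented_uminus)
  interpret relative_poisson_coalgebra scale V \<Delta> \<delta> "\<lambda>x. - P x"
    by (rule coalgebra)
  show ?thesis
  proof
    fix u assume u: "u \<in> V"
    note cl = coproduct_closed[OF u]
    show "\<Delta> (P u) \<approx>\<^sub>2 tmap2 P id (\<Delta> u) - tmap2 id (\<lambda>x. - P x) (\<Delta> u)"
      by (rule tensor2_form_eqI)
         (use u cl in \<open>auto intro!: space_closed simp: pairing_P_form pairing_\<Delta> P_skew P_mul\<close>)
    show "\<delta> (P u) \<approx>\<^sub>2 tmap2 P id (\<delta> u) - tmap2 id (\<lambda>x. - P x) (\<delta> u)"
      by (rule tensor2_form_eqI)
         (use u cl in \<open>auto intro!: space_closed simp: pairing_P_form pairing_\<delta> P_skew P_br\<close>)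
    \<comment> \<open>This is linearity of \<open>\<Delta>\<close>, but \<open>\<Delta> 0\<close> is zero only as a tensor, not as a formal sum.\<close>
    show "tensor_id \<Delta> (\<Delta> (P u + - P u)) \<approx>\<^sub>3 0"
    proof (rule tensor3_form_eqI)
      fix X Y Z assume V: "X \<in> V" "Y \<in> V" "Z \<in> V"
      show "pairing (\<lambda>(x, y, z). \<omega> x X * \<omega> y Y * \<omega> z Z) (tensor_id \<Delta> (\<Delta> (P u + - P u))) =
          pairing (\<lambda>(x, y, z). \<omega> x X * \<omega> y Y * \<omega> z Z) 0"
        using V linear_functional_zero[OF form_linear, of "mul (mul X Y) Z"] coproduct_closed[of 0]
        by (simp del: pairing_tensor_id add: pairing_iterated pairing_\<Delta>)
    qed (auto intro!: space_closed)
  next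
    fix x y assume V: "x \<in> V" "y \<in> V"
    show "\<Delta> (mul x y) \<approx>\<^sub>2 tmap2 (mul x) id (\<Delta> y) + tmap2 id (mul y) (\<Delta> x)"
      by (rule coboundary_mul_mul[OF r_closed V])
    show "\<delta> (br x y) \<approx>\<^sub>2 (tmap2 (br x) id (\<delta> y) + tmap2 id (br x) (\<delta> y))
        - (tmap2 (br y) id (\<delta> x) + tmap2 id (br y) (\<delta> x))"
      by (rule coboundary_br_br[OF r_closed V])
    show "\<delta> (mul x y) - tmap2 id (br y) (\<Delta> x) - tmap2 (mul x) id (\<delta> y)
        - tmap2 id (br x) (\<Delta> y) - tmap2 (mul y) id (\<delta> x) - tmap2 id (\<lambda>x. - P x) (\<Delta> (mul x y)) \<approx>\<^sub>2 0"
      by (rule coboundary_br_mul[OF r_closed r_invariant V])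
    show "\<Delta> (br x y) - tmap2 (mul y) id (\<delta> x) - tmap2 id (br x) (\<Delta> y)
        + tmap2 id (mul y) (\<delta> x) - tmap2 (br x) id (\<Delta> y) + \<Delta> (mul (P x) y) \<approx>\<^sub>2 0"
      by (rule coboundary_mul_br[OF r_closed V])
  qed
qed

end

section \<open>The double of a relative pre-Poisson algebra\<close>

context relative_pre_poisson_algebra
begin

abbreviation "dot \<equiv> subadjacent_mul star"
abbreviation "lie \<equiv> subadjacent_br circ"

lemmas star_simps [simp] = bilinear_opD[OF star_bilinear]
lemmas circ_simps [simp] = bilinear_opD[OF circ_bilinear]
lemmas P_simps [simp] = linear_endoD[OF P_linear]

lemma P_star: "x \<in> V \<Longrightarrow> y \<in> V \<Longrightarrow> P (star x y) = star (P x) y + star x (P y)"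
  using P_derivation_star by (simp add: derivation_of_def)

lemma P_circ: "x \<in> V \<Longrightarrow> y \<in> V \<Longrightarrow> P (circ x y) = circ (P x) y + circ x (P y)"
  using P_derivation_circ by (simp add: derivation_of_def)

lemma dot_closed [simp]: "x \<in> V \<Longrightarrow> y \<in> V \<Longrightarrow> dot x y \<in> V"
  by (simp add: subadjacent_mul_def)

lemma lie_closed [simp]: "x \<in> V \<Longrightarrow> y \<in> V \<Longrightarrow> lie x y \<in> V"
  by (simp add: subadjacent_br_def)

text \<open>
  \<open>star\<close> is a representation of the commutative product, and \<open>circ_lie\<close> says the same for \<open>circ\<close> and the
  bracket.
\<close>

lemma star_dot: "x \<in> V \<Longrightarrow> y \<in> V \<Longrightarrow> z \<in> V \<Longrightarrow> star (dot x y) z = star x (star y z)"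
  using zinbiel[of x y z] by (simp add: subadjacent_mul_def add.commute)

lemma star_left_comm:
  "x \<in> V \<Longrightarrow> y \<in> V \<Longrightarrow> z \<in> V \<Longrightarrow> star x (star y z) = star y (star x z)"
  using zinbiel[of x y z] zinbiel[of y x z] by (simp add: add.commute)

lemma circ_lie:
  "x \<in> V \<Longrightarrow> y \<in> V \<Longrightarrow> z \<in> V \<Longrightarrow> circ (lie x y) z = circ x (circ y z) - circ y (circ x z)"
  using pre_lie[of x y z] by (simp add: subadjacent_br_def algebra_simps)

lemma circ_dot:
  assumes "x \<in> V" "y \<in> V" "z \<in> V"
  shows "circ (dot x y) z = star x (circ y z) + star y (circ x z) - star (dot x y) (P z)"
proof -
  have "(circ (dot x y) z - (star x (circ y z) + star y (circ x z) - star (dot x y) (P z))) = 0"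
    using pre_poisson1[OF assms] unfolding subadjacent_mul_def by (simp only: algebra_simps)
  then show ?thesis by (simp only: right_minus_eq)
qed

text \<open>
  The second mixed axiom, solved for \<open>circ z\<close> after \<open>star x\<close>. Composed with a covector \<open>u\<close>, it is also
  the relative Leibniz rule on the double for a product with \<open>u\<close> as one factor.
\<close>

lemma circ_star:
  assumes "x \<in> V" "y \<in> V" "z \<in> V"
  shows "circ z (star x y) = star x (circ z y) + star (lie z x) y + star (dot x (P z)) y"
proof -
  have "circ z (star x y) - (star x (circ z y) + star (lie z x) y + star (dot x (P z)) y) = 0"
    using pre_poisson2[of x z y] assms unfolding subadjacent_mul_def subadjacent_br_def
    by (simp add: algebra_simps)
  then show ?thesis by (simp only: right_minus_eq)
qed

text \<open>
  The relative Leibniz rule on the double, evaluated on the covector of the acting element,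
  requires the operator on the left to be expressed with \<open>star\<close> applied before \<open>circ\<close>. Commuting the
  operators in \<open>circ_dot\<close> by \<open>circ_star\<close> produces the derivatives of \<open>x\<close> and \<open>y\<close>, which combine with
  the last term to \<open>P (star (dot x y) z)\<close>; the terms with \<open>lie x y\<close> cancel.
\<close>

lemma circ_dot_dual:
  assumes V: "x \<in> V" "y \<in> V" "z \<in> V"
  shows "circ (dot x y) z = circ x (star y z) + circ y (star x z) - P (star (dot x y) z)"
proof -
  have "P (star (dot x y) z) =
      star (dot (P x) y) z + star (dot x (P y)) z + star (dot x y) (P z)"
    using V by (simp add: P_star subadjacent_mul_def algebra_simps)
  moreover have "star (lie x y) z + star (lie y x) z = 0"
    using V by (simp add: subadjacent_br_def)
  moreover have "star (dot (P x) y) z = star (dot y (P x)) z"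
    by (simp add: subadjacent_mul_def add.commute)
  ultimately show ?thesis
    using V by (simp add: circ_dot circ_star[of y z x] circ_star[of x z y] add_eq_0_iff algebra_simps)
qed

theorem subadjacent: "relative_poisson_algebra scale V dot lie P"
proof
  show "bilinear_op scale V dot" "bilinear_op scale V lie"
    by (auto simp: bilinear_op_def linear_endo_def subadjacent_mul_def subadjacent_br_def
        scale_right_distrib scale_right_diff_distrib)
  show "linear_endo scale V P" by (rule P_linear)
  show "derivation_of V dot P" "derivation_of V lie P"
    by (auto simp: derivation_of_def subadjacent_mul_def subadjacent_br_def P_star P_circ)
  fix x assume x: "x \<in> V"
  show "lie x x = 0" by (simp add: subadjacent_br_def)
  fix y assume y: "y \<in> V"
  show "dot x y = dot y x" by (simp add: subadjacent_mul_def add.commute)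
  fix z assume z: "z \<in> V"
  note V = x y z
  have 1: "star z (star x y) = star x (star z y)" "star z (star y x) = star y (star z x)"
    using V star_left_comm by auto
  show "dot (dot x y) z = dot x (dot y z)"
    using V star_dot[of x y z] star_dot[of y z x] 1
    by (simp add: subadjacent_mul_def ac_simps)
  show "lie x (lie y z) + lie y (lie z x) + lie z (lie x y) = 0"
    using V circ_lie[of x y z] circ_lie[of y z x] circ_lie[of z x y]
    by (simp add: subadjacent_br_def)
  have dot_dot: "dot (dot x y) (P z) = star (dot x y) (P z) + star (dot x (P z)) y + star (dot y (P z)) x"
    using V star_dot[of x "P z" y] star_dot[of y "P z" x]
      star_left_comm[of x "P z" y] star_left_comm[of y "P z" x]
    by (simp add: subadjacent_mul_def[of star "dot x y"])
       (simp add: subadjacent_mul_def)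
  have lie_dot: "lie z (dot x y) = circ z (star x y) + circ z (star y x) - circ (dot x y) z"
    using V by (simp add: subadjacent_br_def[of circ z] subadjacent_mul_def)
  have dot_lie: "dot (lie z x) y = star (lie z x) y + star y (circ z x) - star y (circ x z)"
    "dot x (lie z y) = star (lie z y) x + star x (circ z y) - star x (circ y z)"
    using V unfolding subadjacent_mul_def by (simp_all add: subadjacent_br_def)
  show "lie z (dot x y) = dot (lie z x) y + dot x (lie z y) + dot (dot x y) (P z)"
    unfolding dot_dot lie_dot dot_lie using V by (simp add: circ_star circ_dot algebra_simps)
qed

end

lemma dual_space_eq:
  assumes "vector_space scale"
  shows "dual_space scale = {f. linear_functional scale UNIV f}"
proof -
  have "vector_space ((*) :: 'k::field \<Rightarrow> 'k \<Rightarrow> 'k)"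
    by unfold_locales (simp_all add: algebra_simps)
  then show ?thesis
    using assms by (auto simp: dual_space_def Vector_Spaces.linear_iff linear_functional_def)
qed

definition symplectic_form :: "'a \<times> ('a \<Rightarrow> 'k) \<Rightarrow> 'a \<times> ('a \<Rightarrow> 'k) \<Rightarrow> 'k::ab_group_add" where
  "symplectic_form = (\<lambda>(x, u) (y, v). v x - u y)"

context
  fixes scale :: "'k::{alg_closed_field, field_char_0} \<Rightarrow> 'a::ab_group_add \<Rightarrow> 'a"
    and e :: "'i \<Rightarrow> 'a" and e_dual :: "'i \<Rightarrow> 'a \<Rightarrow> 'k" and I :: "'i set"
  assumes vs: "vector_space scale" and fin: "finite I"
    and span_e: "module.span scale (e ` I) = UNIV"
    and e_dual: "\<And>i. i \<in> I \<Longrightarrow> e_dual i \<in> dual_space scale"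
    and dual: "\<And>i j. i \<in> I \<Longrightarrow> j \<in> I \<Longrightarrow> e_dual i (e j) = (if i = j then 1 else 0)"
begin

interpretation vector_space scale by (rule vs)

lemma dualD:
  assumes "u \<in> dual_space scale"
  shows "u (x + y) = u x + u y" "u (scale c x) = c * u x" "u (x - y) = u x - u y" "u (- x) = - u x"
    "u 0 = 0"
proof -
  show add: "u (x + y) = u x + u y" and sc: "u (scale c x) = c * u x" for x y c
    using assms by (auto simp: dual_space_eq[OF vs] linear_functional_def)
  show minus: "u (- x) = - u x" for x using sc[of "-1" x] by simp
  show "u (x - y) = u x - u y" using add[of x "- y"] minus[of y] by simp
  show "u 0 = 0" using sc[of 0 0] by simp
qed

text \<open>
  The right-hand side is linear in \<open>x\<close>, and duality makes the equation true on the spanning family.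
\<close>

lemma vector_expansion: "x = (\<Sum>i\<in>I. scale (e_dual i x) (e i))"
proof -
  have "x \<in> span (e ` I)" by (simp add: span_e)
  then show ?thesis
  proof (induction rule: span_induct_alt)
    case base
    show ?case by (simp add: dualD(5)[OF e_dual])
  next
    case (step c b y)
    then obtain j where j: "j \<in> I" "b = e j" by auto
    have "(\<Sum>i\<in>I. scale (e_dual i (scale c b + y)) (e i)) =
        scale c (\<Sum>i\<in>I. scale (if i = j then 1 else 0) (e i)) + (\<Sum>i\<in>I. scale (e_dual i y) (e i))"
      using j by (simp add: dualD[OF e_dual] dual scale_left_distrib sum.distrib scale_sum_right)
    also have "\<dots> = scale c b + y"
      using j fin step by (simp add: if_distrib[of "\<lambda>c. scale c _"] cong: if_cong)
    finally show ?case by simp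
  qed
qed

lemma covector_expansion:
  assumes u: "u \<in> dual_space scale"
  shows "u v = (\<Sum>i\<in>I. u (e i) * e_dual i v)"
proof -
  have "u (\<Sum>i\<in>A. scale (e_dual i v) (e i)) = (\<Sum>i\<in>A. u (e i) * e_dual i v)" for A
    by (induction A rule: infinite_finite_induct) (auto simp: dualD[OF u])
  then show ?thesis by (subst vector_expansion[of v]) simp
qed

abbreviation (input) "dscale \<equiv> double_scale scale"

lemma double_vector_space: "vector_space dscale"
  by unfold_locales
     (auto simp: double_scale_def scale_right_distrib scale_left_distrib algebra_simps fun_eq_iff)

interpretation D: vector_space dscale by (rule double_vector_space)

lemma sum_fun: "(\<Sum>i\<in>A. f i) x = (\<Sum>i\<in>A. f i x)" for f :: "'i \<Rightarrow> 'a \<Rightarrow> 'k"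
  by (induction A rule: infinite_finite_induct) auto

lemma zero_dual: "0 \<in> dual_space scale"
  by (simp add: dual_space_eq[OF vs] linear_functional_def)

lemma double_expansion:
  assumes "X \<in> double_space scale"
  shows "X = (\<Sum>i\<in>I. dscale (symplectic_form (e i, 0) X) (0, e_dual i)
      - dscale (symplectic_form (0, e_dual i) X) (e i, 0))"
proof (cases X)
  case (Pair x u)
  then have u: "u \<in> dual_space scale" using assms by (simp add: double_space_def)
  show ?thesis
    by (simp add: Pair prod_eq_iff fst_sum snd_sum fun_eq_iff sum_fun symplectic_form_def
        double_scale_def dualD(5)[OF u] vector_expansion[symmetric] covector_expansion[OF u, symmetric])
qed

lemma double_fd_space: "fd_space dscale (double_space scale)"
proof
  show sub: "D.subspace (double_space scale)"
    by (auto simp: D.subspace_def double_space_def double_scale_def dual_space_eq[OF vs]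
        linear_functional_def zero_prod_def algebra_simps)
  let ?B = "(\<lambda>i. (e i, 0)) ` I \<union> (\<lambda>i. (0, e_dual i)) ` I"
  have B: "?B \<subseteq> double_space scale"
    by (auto simp: double_space_def zero_dual e_dual)
  have "double_space scale \<subseteq> D.span ?B"
  proof
    fix X assume X: "X \<in> double_space scale"
    show "X \<in> D.span ?B"
      by (subst double_expansion[OF X], rule D.span_sum, rule D.span_diff)
         (rule D.span_scale, rule D.span_base, simp)+
  qed
  then have "D.span ?B = double_space scale"
    using D.span_minimal[OF B sub] by auto
  then show "\<exists>B. finite B \<and> B \<subseteq> double_space scale \<and> D.span B = double_space scale"
    using fin B by (intro exI[of _ ?B]) auto
qed

context
  fixes star circ P
  assumes pp: "relative_pre_poisson_algebra scale UNIV star circ P"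
begin

interpretation A: relative_pre_poisson_algebra scale UNIV star circ P by (rule pp)
interpretation S: relative_poisson_algebra scale UNIV A.dot A.lie P by (rule A.subadjacent)

abbreviation (input) "dmul \<equiv> semidirect_mul A.dot (\<lambda>x u. - dual_rep star x u)"
abbreviation (input) "dbr \<equiv> semidirect_br A.lie (dual_rep circ)"
abbreviation (input) "dP \<equiv> map_prod P (\<lambda>u. - dual_map P u)"

lemma double_simps:
  "dmul (x, u) (y, v) = (A.dot x y, \<lambda>w. v (star x w) + u (star y w))"
  "dbr (x, u) (y, v) = (A.lie x y, \<lambda>w. u (circ y w) - v (circ x w))"
  "dP (x, u) = (P x, \<lambda>w. - u (P w))"
  "dscale c (x, u) = (scale c x, \<lambda>w. c * u w)"
  by (auto simp: semidirect_mul_def semidirect_br_def dual_rep_def dual_map_def double_scale_def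
      fun_eq_iff)

lemma compose_dual:
  assumes "u \<in> dual_space scale"
  shows "(\<lambda>w. u (star x w)) \<in> dual_space scale" "(\<lambda>w. u (circ x w)) \<in> dual_space scale"
    "(\<lambda>w. u (P w)) \<in> dual_space scale"
  using assms by (auto simp: dual_space_eq[OF vs] linear_functional_def)

lemma dual_closed:
  assumes "u \<in> dual_space scale" "v \<in> dual_space scale"
  shows "(\<lambda>w. u w + v w) \<in> dual_space scale" "(\<lambda>w. u w - v w) \<in> dual_space scale"
    "(\<lambda>w. - u w) \<in> dual_space scale"
  using assms by (auto simp: dual_space_eq[OF vs] linear_functional_def algebra_simps)

text \<open>
  On the first component the axioms are those of the sub-adjacent algebra. On the second component,
  evaluated at a vector, each of the covectors \<open>u\<close>, \<open>v\<close>, \<open>w\<close> has to agree on two compositions of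
  operators \<open>star x\<close>, \<open>circ x\<close> and \<open>P\<close>.
\<close>

lemma double_relative_poisson: "relative_poisson_algebra dscale (double_space scale) dmul dbr dP"
proof -
  interpret fd_space dscale "double_space scale" by (rule double_fd_space)
  show ?thesis
  proof
    show "bilinear_op dscale (double_space scale) dmul"
      by (auto simp: bilinear_op_def linear_endo_def double_space_def double_simps dualD fun_eq_iff
          algebra_simps intro!: compose_dual dual_closed)
    show "bilinear_op dscale (double_space scale) dbr"
      by (auto simp: bilinear_op_def linear_endo_def double_space_def double_simps dualD fun_eq_iff
          algebra_simps intro!: compose_dual dual_closed)
    show "linear_endo dscale (double_space scale) dP"
      by (auto simp: linear_endo_def double_space_def double_simps dualD fun_eq_iff
          simp del: map_prod_simp intro!: compose_dual dual_closed)
    show "derivation_of (double_space scale) dmul dP"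
      by (auto simp: derivation_of_def double_space_def double_simps dualD fun_eq_iff
          S.P_mul A.P_star simp del: map_prod_simp)
    show "derivation_of (double_space scale) dbr dP"
      by (auto simp: derivation_of_def double_space_def double_simps dualD fun_eq_iff
          S.P_br A.P_circ simp del: map_prod_simp)
    fix X assume "X \<in> double_space scale"
    then obtain x u where X: "X = (x, u)" and u: "u \<in> dual_space scale"
      by (auto simp: double_space_def)
    show "dbr X X = 0"
      by (simp add: X double_simps S.br_alternating zero_prod_def fun_eq_iff)
    fix Y assume "Y \<in> double_space scale"
    then obtain y v where Y: "Y = (y, v)" and v: "v \<in> dual_space scale"
      by (auto simp: double_space_def)
    show "dmul X Y = dmul Y X"
      by (simp add: X Y double_simps S.mul_comm[of x y] add.commute)
    fix Z assume "Z \<in> double_space scale"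
    then obtain z w where Z: "Z = (z, w)" and w: "w \<in> dual_space scale"
      by (auto simp: double_space_def)
    show "dmul (dmul X Y) Z = dmul X (dmul Y Z)"
      by (simp add: X Y Z double_simps S.mul_assoc A.star_dot A.star_left_comm fun_eq_iff)
    show "dbr X (dbr Y Z) + dbr Y (dbr Z X) + dbr Z (dbr X Y) = 0"
      using S.jacobi[of x y z]
      by (simp add: X Y Z double_simps A.circ_lie zero_prod_def fun_eq_iff dualD[OF u] dualD[OF v]
          dualD[OF w])
    \<comment> \<open>The covectors of the two factors use \<open>circ_star\<close>, that of the acting element \<open>circ_dot_dual\<close>.\<close>
    have "v (circ z (star x t)) = v (star x (circ z t)) + v (star (A.lie z x) t)
        + v (star (A.dot x (P z)) t)"
      and "u (circ z (star y t)) = u (star y (circ z t)) + u (star (A.lie z y) t)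
        + u (star (A.dot y (P z)) t)"
      and "w (circ (A.dot x y) t) = w (circ x (star y t)) + w (circ y (star x t))
        - w (P (star (A.dot x y) t))" for t
      by (simp_all add: A.circ_star A.circ_dot_dual dualD[OF u] dualD[OF v] dualD[OF w])
    then show "dbr Z (dmul X Y) = dmul (dbr Z X) Y + dmul X (dbr Z Y) + dmul (dmul X Y) (dP Z)"
      by (simp add: X Y Z double_simps S.relative_leibniz fun_eq_iff A.star_dot[symmetric]
          S.mul_comm[of "P z"] del: map_prod_simp)
  qed
qed

text \<open>
  The form of a product, \<open>\<omega>((x + u)(y + v), z + w) = w(x y) - v(x \<star> z) - u(y \<star> z)\<close>, involves each
  covector with the two halves of the sub-adjacent product; summing cyclically they cancel. For the
  bracket the same happens with \<open>\<circ>\<close>.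
\<close>

lemma double_symplectic:
  "symplectic_relative_poisson_algebra dscale (double_space scale) dmul dbr dP symplectic_form I
     (\<lambda>i. (e i, 0)) (\<lambda>i. (0, e_dual i))"
proof -
  interpret relative_poisson_algebra dscale "double_space scale" dmul dbr dP
    by (rule double_relative_poisson)
  show ?thesis
  proof
    show "linear_functional dscale (double_space scale) (\<lambda>U. symplectic_form U X)"
      if "X \<in> double_space scale" for X
      using that by (auto simp: linear_functional_def double_space_def symplectic_form_def
          double_simps dualD algebra_simps)
    show "symplectic_form X Y = - symplectic_form Y X" for X Y :: "'a \<times> ('a \<Rightarrow> 'k)"
      by (simp add: symplectic_form_def split_beta)
    show "(e i, 0) \<in> double_space scale" "(0, e_dual i) \<in> double_space scale" if "i \<in> I" for i
      using that by (auto simp: double_space_def zero_dual e_dual)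
    show "X = (\<Sum>i\<in>I. dscale (symplectic_form (e i, 0) X) (0, e_dual i)
      - dscale (symplectic_form (0, e_dual i) X) (e i, 0))" if "X \<in> double_space scale" for X
      using that by (rule double_expansion)
    fix X assume "X \<in> double_space scale"
    then obtain x u where X: "X = (x, u)" and u: "u \<in> dual_space scale"
      by (auto simp: double_space_def)
    fix Y assume "Y \<in> double_space scale"
    then obtain y v where Y: "Y = (y, v)" and v: "v \<in> dual_space scale"
      by (auto simp: double_space_def)
    show "symplectic_form (dP X) Y = - symplectic_form X (dP Y)"
      by (simp add: X Y symplectic_form_def double_simps del: map_prod_simp)
    fix Z assume "Z \<in> double_space scale"
    then obtain z w where Z: "Z = (z, w)" and w: "w \<in> dual_space scale"
      by (auto simp: double_space_def)
    show "symplectic_form (dmul X Y) Z + symplectic_form (dmul Y Z) X + symplectic_form (dmul Z X) Y = 0"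
      by (simp add: X Y Z symplectic_form_def double_simps subadjacent_mul_def
          dualD[OF u] dualD[OF v] dualD[OF w])
    show "symplectic_form (dbr X Y) Z + symplectic_form (dbr Y Z) X + symplectic_form (dbr Z X) Y = 0"
      by (simp add: X Y Z symplectic_form_def double_simps subadjacent_br_def
          dualD[OF u] dualD[OF v] dualD[OF w])
  qed
qed

end

end

theorem proposition4p23:
  fixes scale :: "'k::{alg_closed_field, field_char_0} \<Rightarrow> 'a::ab_group_add \<Rightarrow> 'a"
    and star circ :: "'a \<Rightarrow> 'a \<Rightarrow> 'a" and P :: "'a \<Rightarrow> 'a"
    and n :: nat and e :: "nat \<Rightarrow> 'a" and e_dual :: "nat \<Rightarrow> 'a \<Rightarrow> 'k"
    and D :: "('a \<times> ('a \<Rightarrow> 'k)) set" and scl and mul br and PD QD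
    and r :: "('a \<times> ('a \<Rightarrow> 'k)) \<times> ('a \<times> ('a \<Rightarrow> 'k)) \<Rightarrow>\<^sub>0 'k" and \<Delta> \<delta>
  assumes pre_poisson: "relative_pre_poisson_algebra scale UNIV star circ P"
    and basis: "inj_on e {1..n}" "\<not> module.dependent scale (e ` {1..n})"
      "module.span scale (e ` {1..n}) = UNIV"
    and dual_basis: "\<forall>i\<in>{1..n}. e_dual i \<in> dual_space scale \<and>
      (\<forall>j\<in>{1..n}. e_dual i (e j) = (if i = j then 1 else 0))"
  defines "D \<equiv> double_space scale"
    and "scl \<equiv> double_scale scale"
    and "mul \<equiv> semidirect_mul (subadjacent_mul star) (\<lambda>x u. - dual_rep star x u)"
    and "br \<equiv> semidirect_br (subadjacent_br circ) (dual_rep circ)"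
    and "PD \<equiv> map_prod P (\<lambda>u. - dual_map P u)"
    and "QD \<equiv> map_prod (\<lambda>x. - P x) (dual_map P)"
    and "r \<equiv> (\<Sum>i = 1..n. pure2 (e i, 0) (0, e_dual i) - pure2 (0, e_dual i) (e i, 0))"
    and "\<Delta> \<equiv> (\<lambda>u. tmap2 id (mul u) r - tmap2 (mul u) id r)"
    and "\<delta> \<equiv> (\<lambda>u. tmap2 (br u) id r + tmap2 id (br u) r)"
  shows "relative_poisson_algebra scl D mul br PD \<and>
    antisymmetric_tensor scl D r \<and> rpybe_solution scl D mul br PD QD r \<and>
    dually_represented scl D mul br PD QD \<and>
    relative_poisson_bialgebra scl D mul br \<Delta> \<delta> PD QD"
proof -
  interpret A: relative_pre_poisson_algebra scale UNIV star circ P by (rule pre_poisson)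
  interpret S: symplectic_relative_poisson_algebra scl D mul br PD symplectic_form "{1..n}"
      "\<lambda>i. (e i, 0)" "\<lambda>i. (0, e_dual i)"
    unfolding scl_def D_def mul_def br_def PD_def
    by (rule double_symplectic[OF A.vector_space_axioms _ basis(3) _ _ pre_poisson])
       (use dual_basis in auto)
  have Q: "QD = (\<lambda>X. - PD X)"
    by (auto simp: QD_def PD_def fun_eq_iff)
  have r: "r = S.r"
    by (simp only: r_def S.r_def)
  have "\<Delta> = S.\<Delta>" "\<delta> = S.\<delta>"
    by (simp_all add: \<Delta>_def \<delta>_def r coboundary_mul_def coboundary_br_def fun_eq_iff)
  then show ?thesis
    using S.relative_poisson_algebra_axioms S.antisymmetric_r S.rpybe_solution_r
      S.dually_represented_uminus S.bialgebra
    by (simp add: Q r)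
qed

end
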